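(* Let $n\ge2$ and $N=\frac{n(n-1)}{2}$. Let $R$ be a complete discrete valuation ring with maximal ideal $\mathfrak{p}$, residue field $k$, and residue characteristic $p$. Let $A$ be a finite free commutative $R$-algebra of rank $n$ such that: (i) $A$ is a discrete valuation ring with maximal ideal $\mathfrak{m}$; (ii) $A/\mathfrak{m}\cong k$; (iii) there exists a uniformizer $\pi\in\mathfrak{m}$ with $A=R[\pi]$. Fix an orientation $\omega\in\bigwedge^n_R A$ and let $f_\omega:A\to R$ be the associated index form. Assume $p\nmid N$. Then the set of unit values of $f_\omega$ on $R$-generators of $A$ is a single coset: $$\{f_\omega(\beta)\in R^\times:\ \beta\in A,\ A=R[\beta]\}=f_\omega(\pi)\cdot(R^\times)^N.$$ Equivalently, the composite map $$\{\beta\in A: A=R[\beta]\}\xrightarrow{\ f_\omega\ }R^\times\longrightarrow R^\times/(R^\times)^N\cong H^1(\operatorname{Spec}R,\mu_N)$$ is constant, with value the class $[f_\omega(\pi)]$.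
   Context: An orientation of a finite free $R$-algebra $A$ of rank $n$ is a generator $\omega$ of the free rank-one $R$-module $\bigwedge^n_R A$. The index form $f_\omega:A\to R$ is defined by $1\wedge\beta\wedge\beta^2\wedge\cdots\wedge\beta^{n-1}=f_\omega(\beta)\,\omega$ for $\beta\in A$. $(R^\times)^N$ denotes the subgroup of $N$-th powers in $R^\times$, and $\mu_N$ is the group scheme of $N$-th roots of unity. The isomorphism $R^\times/(R^\times)^N\cong H^1(\operatorname{Spec}R,\mu_N)$ is the one given by the Kummer sequence (sending $u$ to the class of the $\mu_N$-torsor $\operatorname{Spec}R[y]/(y^N-u)$); $[u]$ denotes the class of $u\in R^\times$. *)

theory Defs
  imports
    "HOL-Algebra.Algebra"
    "HOL-Algebra.Algebraic_Closure_Type"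
    "HOL-Library.Poly_Mapping"
    "HOL-Computational_Algebra.Polynomial"
begin

abbreviation rng :: "'a::comm_ring_1 ring"
  where "rng \<equiv> ring_of_type_algebra"


section \<open>Discrete valuation rings\<close>

definition dvr_with_maximal :: "'a::idom set \<Rightarrow> bool" where
  "dvr_with_maximal P \<longleftrightarrow>
     principal_domain (rng :: 'a ring) \<and>
     (\<forall>J. maximalideal J (rng :: 'a ring) \<longleftrightarrow> J = P) \<and>
     P \<noteq> {0}"

definition ideal_power :: "'a::comm_ring_1 set \<Rightarrow> nat \<Rightarrow> 'a set" where
  "ideal_power I k = (ideal_prod rng I ^^ k) UNIV"

text \<open>Convergence of Cauchy sequences in the adic topology. Separatedness is not demanded: it
  holds in every discrete valuation ring.\<close>

definition adically_complete :: "'a::comm_ring_1 set \<Rightarrow> bool" where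
  "adically_complete I \<longleftrightarrow>
     (\<forall>x :: nat \<Rightarrow> 'a.
        (\<forall>k. \<exists>m. \<forall>i\<ge>m. \<forall>j\<ge>m. x i - x j \<in> ideal_power I k) \<longrightarrow>
        (\<exists>l. \<forall>k. \<exists>m. \<forall>i\<ge>m. x i - l \<in> ideal_power I k))"


section \<open>Algebras over a ring\<close>

text \<open>The \<open>R\<close>-algebra structure on a commutative ring is given by its scalar multiplication; the
  structure map is \<open>r \<mapsto> scale r 1\<close>.\<close>

definition comm_algebra :: "('r::comm_ring_1 \<Rightarrow> 'a::comm_ring_1 \<Rightarrow> 'a) \<Rightarrow> bool" where
  "comm_algebra scale \<longleftrightarrow>
     Modules.module scale \<and> (\<forall>r x y. scale r x * y = scale r (x * y))"

definition free_of_rank :: "('r::comm_ring_1 \<Rightarrow> 'a::ab_group_add \<Rightarrow> 'a) \<Rightarrow> nat \<Rightarrow> bool" where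
  "free_of_rank scale n \<longleftrightarrow>
     (\<exists>E. finite E \<and> card E = n \<and> \<not> Modules.module.dependent scale E \<and>
          Modules.module.span scale E = UNIV)"

definition adjoin :: "('r::comm_ring_1 \<Rightarrow> 'a::comm_ring_1 \<Rightarrow> 'a) \<Rightarrow> 'a \<Rightarrow> 'a set" where
  "adjoin scale \<beta> = range (\<lambda>q :: 'r poly. poly (map_poly (\<lambda>r. scale r 1) q) \<beta>)"


section \<open>Exterior powers and the index form\<close>

text \<open>The \<open>n\<close>-th exterior power is the free module on \<open>n\<close>-tuples modulo the submodule spanned
  by the relations of multilinearity and alternation.\<close>

definition free_scale :: "'r::comm_ring_1 \<Rightarrow> ('b \<Rightarrow>\<^sub>0 'r) \<Rightarrow> ('b \<Rightarrow>\<^sub>0 'r)" where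
  "free_scale r x = Poly_Mapping.map ((*) r) x"

definition free_on_tuples :: "nat \<Rightarrow> ('m list \<Rightarrow>\<^sub>0 'r::comm_ring_1) set" where
  "free_on_tuples n = {x. Poly_Mapping.keys x \<subseteq> {xs. length xs = n}}"

definition wedge_relations ::
    "('r::comm_ring_1 \<Rightarrow> 'm::ab_group_add \<Rightarrow> 'm) \<Rightarrow> nat \<Rightarrow> ('m list \<Rightarrow>\<^sub>0 'r) set" where
  "wedge_relations scale n =
     {Poly_Mapping.single (xs[i := x + y]) 1 - Poly_Mapping.single (xs[i := x]) 1
        - Poly_Mapping.single (xs[i := y]) 1 | xs i x y. length xs = n \<and> i < n} \<union>
     {Poly_Mapping.single (xs[i := scale r x]) 1 - Poly_Mapping.single (xs[i := x]) r
        | xs i r x. length xs = n \<and> i < n} \<union>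
     {Poly_Mapping.single xs 1 | xs i j. length xs = n \<and> i < j \<and> j < n \<and> xs ! i = xs ! j}"

definition ext_rel ::
    "('r::comm_ring_1 \<Rightarrow> 'm::ab_group_add \<Rightarrow> 'm) \<Rightarrow> nat \<Rightarrow>
     (('m list \<Rightarrow>\<^sub>0 'r) \<times> ('m list \<Rightarrow>\<^sub>0 'r)) set" where
  "ext_rel scale n =
     {(x, y). x \<in> free_on_tuples n \<and> y \<in> free_on_tuples n \<and>
              x - y \<in> Modules.module.span free_scale (wedge_relations scale n)}"

definition ext_power ::
    "('r::comm_ring_1 \<Rightarrow> 'm::ab_group_add \<Rightarrow> 'm) \<Rightarrow> nat \<Rightarrow> ('m list \<Rightarrow>\<^sub>0 'r) set set" where
  "ext_power scale n = free_on_tuples n // ext_rel scale n"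

definition ext_scale ::
    "('r::comm_ring_1 \<Rightarrow> 'm::ab_group_add \<Rightarrow> 'm) \<Rightarrow> nat \<Rightarrow>
     'r \<Rightarrow> ('m list \<Rightarrow>\<^sub>0 'r) set \<Rightarrow> ('m list \<Rightarrow>\<^sub>0 'r) set" where
  "ext_scale scale n r W = (\<Union>x\<in>W. ext_rel scale n `` {free_scale r x})"

definition wedge ::
    "('r::comm_ring_1 \<Rightarrow> 'm::ab_group_add \<Rightarrow> 'm) \<Rightarrow> 'm list \<Rightarrow> ('m list \<Rightarrow>\<^sub>0 'r) set" where
  "wedge scale xs = ext_rel scale (length xs) `` {Poly_Mapping.single xs 1}"

definition orientation ::
    "('r::comm_ring_1 \<Rightarrow> 'm::ab_group_add \<Rightarrow> 'm) \<Rightarrow> nat \<Rightarrow> ('m list \<Rightarrow>\<^sub>0 'r) set \<Rightarrow> bool" where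
  "orientation scale n \<omega> \<longleftrightarrow>
     \<omega> \<in> ext_power scale n \<and> (\<forall>W \<in> ext_power scale n. \<exists>r. W = ext_scale scale n r \<omega>)"

definition index_form ::
    "('r::comm_ring_1 \<Rightarrow> 'a::comm_ring_1 \<Rightarrow> 'a) \<Rightarrow> nat \<Rightarrow> ('a list \<Rightarrow>\<^sub>0 'r) set \<Rightarrow> 'a \<Rightarrow> 'r" where
  "index_form scale n \<omega> \<beta> =
     (THE c. wedge scale (map (\<lambda>i. \<beta> ^ i) [0..<n]) = ext_scale scale n c \<omega>)"


section \<open>Units modulo powers\<close>

definition unit_group :: "'r::comm_ring_1 monoid" where
  "unit_group = units_of rng"

definition unit_powers :: "nat \<Rightarrow> 'r::comm_ring_1 set" where
  "unit_powers N = (\<lambda>v. v ^ N) ` carrier unit_group"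

definition unit_class :: "nat \<Rightarrow> 'r::comm_ring_1 \<Rightarrow> 'r set" where
  "unit_class N u = unit_powers N #>\<^bsub>unit_group\<^esub> u"


section \<open>Torsors under the group scheme of roots of unity\<close>

text \<open>An affine scheme \<open>Spec B\<close> over \<open>Spec R\<close> with an action of \<open>\<mu>\<^sub>N\<close> is an \<open>R\<close>-algebra \<open>B\<close> with a
  coaction \<open>\<rho> : B \<rightarrow> B \<otimes> R[z]/(z\<^sup>N - 1)\<close>. The target is \<open>B[z]/(z\<^sup>N - 1)\<close>, with \<open>B\<close>-basis
  \<open>1, z, \<dots>, z\<^sup>N\<^sup>-\<^sup>1\<close>, and \<open>coact B i\<close> is the \<open>z\<^sup>i\<close>-component of \<open>\<rho>\<close>, for \<open>i < N\<close>.\<close>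

record ('r, 'b) mu_algebra = "('r, 'b) module" +
  coact :: "nat \<Rightarrow> 'b \<Rightarrow> 'b"

text \<open>The conditions say, in this order, that \<open>\<rho>\<close> takes values in \<open>B[z]/(z\<^sup>N - 1)\<close>, is a
  homomorphism of \<open>R\<close>-algebras (multiplication in \<open>B[z]/(z\<^sup>N - 1)\<close> is cyclic convolution of the
  components), and is counital (\<open>z \<mapsto> 1\<close>) and coassociative (\<open>z \<mapsto> z \<otimes> z\<close>).\<close>

definition mu_coaction :: "nat \<Rightarrow> ('r::comm_ring_1, 'b) mu_algebra \<Rightarrow> bool" where
  "mu_coaction N B \<longleftrightarrow>
     algebra (rng :: 'r ring) B \<and>
     (\<forall>i<N. coact B i \<in> carrier B \<rightarrow> carrier B) \<and>
     (\<forall>i<N. \<forall>x\<in>carrier B. \<forall>y\<in>carrier B.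
        coact B i (x \<oplus>\<^bsub>B\<^esub> y) = coact B i x \<oplus>\<^bsub>B\<^esub> coact B i y) \<and>
     (\<forall>i<N. \<forall>r. \<forall>x\<in>carrier B. coact B i (r \<odot>\<^bsub>B\<^esub> x) = r \<odot>\<^bsub>B\<^esub> coact B i x) \<and>
     (\<forall>i<N. coact B i \<one>\<^bsub>B\<^esub> = (if i = 0 then \<one>\<^bsub>B\<^esub> else \<zero>\<^bsub>B\<^esub>)) \<and>
     (\<forall>i<N. \<forall>x\<in>carrier B. \<forall>y\<in>carrier B.
        coact B i (x \<otimes>\<^bsub>B\<^esub> y) =
          (\<Oplus>\<^bsub>B\<^esub>j\<in>{..<N}. coact B j x \<otimes>\<^bsub>B\<^esub> coact B ((i + N - j) mod N) y)) \<and>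
     (\<forall>x\<in>carrier B. (\<Oplus>\<^bsub>B\<^esub>i\<in>{..<N}. coact B i x) = x) \<and>
     (\<forall>i<N. \<forall>j<N. \<forall>x\<in>carrier B.
        coact B i (coact B j x) = (if i = j then coact B j x else \<zero>\<^bsub>B\<^esub>))"

definition module_basis :: "('r::comm_ring_1, 'b, 'c) module_scheme \<Rightarrow> 'b set \<Rightarrow> bool" where
  "module_basis B E \<longleftrightarrow>
     finite E \<and> E \<subseteq> carrier B \<and>
     (\<forall>x\<in>carrier B. \<exists>!c. c \<in> E \<rightarrow>\<^sub>E UNIV \<and> x = (\<Oplus>\<^bsub>B\<^esub>e\<in>E. c e \<odot>\<^bsub>B\<^esub> e))"

text \<open>Torsors over a local ring \<open>R\<close>. A \<open>\<mu>\<^sub>N\<close>-torsor over \<open>Spec R\<close> is affine, \<open>B\<close> is finite and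
  faithfully flat over \<open>R\<close> --- since \<open>R\<close> is local, \<open>B\<close> is free of finite positive rank ---, and
  \<open>b' \<otimes> b \<mapsto> b' \<rho>(b)\<close> is an isomorphism from \<open>B \<otimes>\<^sub>R B\<close> to \<open>B[z]/(z\<^sup>N - 1)\<close>. An \<open>R\<close>-basis \<open>E\<close> of \<open>B\<close>
  induces a basis of \<open>B \<otimes>\<^sub>R B\<close> over the left factor, so the last condition says that every
  element \<open>\<Sum>\<^sub>i g i z\<^sup>i\<close> is uniquely a \<open>B\<close>-linear combination of the \<open>\<rho>(e)\<close>, \<open>e \<in> E\<close>.\<close>

definition mu_torsor :: "nat \<Rightarrow> ('r::comm_ring_1, 'b) mu_algebra \<Rightarrow> bool" where
  "mu_torsor N B \<longleftrightarrow>
     mu_coaction N B \<and>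
     (\<exists>E. E \<noteq> {} \<and> module_basis B E \<and>
        (\<forall>g \<in> {..<N} \<rightarrow>\<^sub>E carrier B.
           \<exists>!c. c \<in> E \<rightarrow>\<^sub>E carrier B \<and>
                (\<forall>i<N. g i = (\<Oplus>\<^bsub>B\<^esub>e\<in>E. c e \<otimes>\<^bsub>B\<^esub> coact B i e))))"

definition mu_isomorphic ::
    "nat \<Rightarrow> ('r::comm_ring_1, 'b) mu_algebra \<Rightarrow> ('r, 'c) mu_algebra \<Rightarrow> bool" where
  "mu_isomorphic N B B' \<longleftrightarrow>
     (\<exists>h \<in> ring_iso B B'. \<forall>x\<in>carrier B.
        (\<forall>r. h (r \<odot>\<^bsub>B\<^esub> x) = r \<odot>\<^bsub>B'\<^esub> h x) \<and> (\<forall>i<N. h (coact B i x) = coact B' i (h x)))"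

text \<open>\<open>H\<^sup>1(Spec R, \<mu>\<^sub>N)\<close> is the set of isomorphism classes of \<open>\<mu>\<^sub>N\<close>-torsors. As they are free of
  finite rank, all of them occur, up to isomorphism, on subsets of the type \<open>'r poly set\<close> when
  \<open>R\<close> is infinite, in particular when it is a discrete valuation ring.\<close>

definition torsor_rel ::
    "nat \<Rightarrow> (('r::comm_ring_1, 'r poly set) mu_algebra \<times> ('r, 'r poly set) mu_algebra) set" where
  "torsor_rel N = {(B, B'). mu_torsor N B \<and> mu_torsor N B' \<and> mu_isomorphic N B B'}"

definition H1_mu :: "nat \<Rightarrow> ('r::comm_ring_1, 'r poly set) mu_algebra set set" where
  "H1_mu N = {B. mu_torsor N B} // torsor_rel N"

text \<open>The torsor \<open>Spec R[y]/(y\<^sup>N - u)\<close>, on which \<open>\<zeta> \<in> \<mu>\<^sub>N\<close> acts by \<open>y \<mapsto> \<zeta> y\<close>. The coaction is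
  \<open>y \<mapsto> y \<otimes> z\<close>, so its \<open>z\<^sup>i\<close>-component retains the monomials of degree congruent to \<open>i\<close>
  modulo \<open>N\<close>.\<close>

definition kummer_ideal :: "nat \<Rightarrow> 'r::comm_ring_1 \<Rightarrow> 'r poly set" where
  "kummer_ideal N u = PIdl\<^bsub>rng\<^esub> (Polynomial.monom 1 N - [:u:])"

definition degree_part :: "nat \<Rightarrow> nat \<Rightarrow> 'r::comm_ring_1 poly \<Rightarrow> 'r poly" where
  "degree_part N i q =
     (\<Sum>j \<in> {j. j \<le> Polynomial.degree q \<and> j mod N = i}. Polynomial.monom (Polynomial.coeff q j) j)"

definition kummer_torsor :: "nat \<Rightarrow> 'r::comm_ring_1 \<Rightarrow> ('r, 'r poly set) mu_algebra" where
  "kummer_torsor N u =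
     (let I = kummer_ideal N u; Q = rng Quot I in
      \<lparr>carrier = carrier Q, monoid.mult = monoid.mult Q, one = one Q, ring.zero = ring.zero Q,
       add = add Q,
       Module.module.smult = (\<lambda>r C. \<Union>q\<in>C. I +>\<^bsub>rng\<^esub> Polynomial.smult r q),
       coact = (\<lambda>i C. \<Union>q\<in>C. I +>\<^bsub>rng\<^esub> degree_part N i q)\<rparr>)"

definition kummer_class :: "nat \<Rightarrow> 'r::comm_ring_1 \<Rightarrow> ('r, 'r poly set) mu_algebra set" where
  "kummer_class N u = torsor_rel N `` {kummer_torsor N u}"

text \<open>The map induced by \<open>kummer_class\<close> on the cosets of the \<open>N\<close>-th powers; the union is over
  equal sets.\<close>

definition kummer_map :: "nat \<Rightarrow> 'r::comm_ring_1 set \<Rightarrow> ('r, 'r poly set) mu_algebra set" where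
  "kummer_map N C = (\<Union>u\<in>C. kummer_class N u)"

end

theory Submission
  imports
    Defs
    "Jordan_Normal_Form.Char_Poly"
    "HOL-Number_Theory.Cong"
begin

text \<open>Everything rests on one determinant. The powers \<open>1, \<pi>, \<dots>, \<pi>\<^sup>n\<^sup>-\<^sup>1\<close> form a basis of \<open>A\<close>
  (\<open>free_algebra_powers\<close>, by the Cayley--Hamilton argument in \<open>integral_equation\<close>). The determinant
  of the coordinates in a basis, called the volume of a list, is multilinear and alternating, so it
  induces a functional on the top exterior power; this makes the coefficient in the index form unique
  and shows \<open>f(\<beta>) = f(\<pi>) \<cdot> vol(1, \<beta>, \<dots>, \<beta>\<^sup>n\<^sup>-\<^sup>1)\<close> with \<open>f(\<pi>)\<close> a unit (\<open>orientation_index_form\<close>).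
  It remains to see which volumes occur.

  A generator that is a uniformizer forces total ramification: \<open>A/PA\<close> is \<open>k[x]/(x\<^sup>n)\<close>, with \<open>x\<close> the
  class of \<open>\<pi>\<close> (\<open>pi_power_dvd_incl\<close>, \<open>coord_in_maximal\<close>). The volume is invariant under
  \<open>\<beta> \<mapsto> \<beta> - b\<close> for \<open>b\<close> in \<open>R\<close>, so one may take \<open>\<beta> = a \<pi> + \<dots>\<close> with \<open>a\<close> in \<open>R\<close>. Then
  \<open>\<beta>\<^sup>i = a\<^sup>i \<pi>\<^sup>i + \<dots>\<close>, the coordinate matrix is triangular modulo \<open>P\<close>, and the volume is congruent
  to \<open>a\<^sup>0 a\<^sup>1 \<cdots> a\<^sup>n\<^sup>-\<^sup>1 = a\<^sup>N\<close> (\<open>volume_powers_residue\<close>). When \<open>\<beta>\<close> generates \<open>A\<close> the volume is a unit,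
  hence so is \<open>a\<close>. As \<open>N\<close> is invertible in \<open>R\<close> and \<open>R\<close> is complete, every element of \<open>1 + P\<close> is
  an \<open>N\<close>-th power (\<open>power_root_near_one\<close>), so the congruence gives an exact \<open>N\<close>-th power
  (\<open>volume_powers_is_power\<close>). Conversely \<open>v \<pi>\<close>, for a unit \<open>v\<close>, is a generator of volume \<open>v\<^sup>N\<close>.

  For the cohomological form, \<open>R[y]/(y\<^sup>N - u)\<close> is a torsor because the powers of \<open>y\<close> diagonalise the
  coaction and \<open>y\<close> is invertible (\<open>mu_torsor_kummer\<close>), and rescaling \<open>y\<close> by a unit \<open>v\<close> shows that its
  class is unchanged when \<open>u\<close> is multiplied by \<open>v\<^sup>N\<close> (\<open>kummer_class_mult_power\<close>).\<close>

section \<open>Rings given by types\<close>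

lemma rng_simps [simp]:
  "carrier (rng :: 'a::comm_ring_1 ring) = UNIV"
  "x \<otimes>\<^bsub>rng\<^esub> y = x * (y :: 'a)"
  "x \<oplus>\<^bsub>rng\<^esub> y = x + (y :: 'a)"
  "\<one>\<^bsub>rng\<^esub> = (1 :: 'a)"
  "\<zero>\<^bsub>rng\<^esub> = (0 :: 'a)"
  by (simp_all add: ring_of_type_algebra_def)

lemma a_minus_rng: "x \<ominus>\<^bsub>rng\<^esub> y = x - (y :: 'a::comm_ring_1)"
proof -
  interpret cring "rng :: 'a ring" by (rule cring_from_type_algebra)
  have "\<ominus>\<^bsub>rng\<^esub> y = - y" using minus_equality[of "- y" y] by simp
  then show ?thesis by (simp add: a_minus_def)
qed

lemma Units_rng: "Units (rng :: 'a::comm_ring_1 ring) = {x. x dvd 1}"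
proof (intro equalityI subsetI)
  fix x :: 'a assume "x \<in> {x. x dvd 1}"
  then obtain y where "1 = x * y" by (auto elim: dvdE)
  then show "x \<in> Units rng" unfolding Units_def by (auto intro!: exI[of _ y] simp: mult.commute)
qed (auto simp: Units_def dvd_def mult.commute)

lemma cgenideal_rng: "PIdl\<^bsub>rng\<^esub> x = {y :: 'a::comm_ring_1. x dvd y}"
  by (auto simp: cgenideal_def dvd_def mult.commute)

lemma ideal_rng_mult: "ideal I (rng :: 'a::comm_ring_1 ring) \<Longrightarrow> x \<in> I \<Longrightarrow> r * x \<in> I"
  using ideal.I_l_closed[of I rng x r] by simp

lemma ideal_rng_add: "ideal I (rng :: 'a::comm_ring_1 ring) \<Longrightarrow> x \<in> I \<Longrightarrow> y \<in> I \<Longrightarrow> x + y \<in> I"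
  using additive_subgroup.a_closed[OF ideal.axioms(1), of I rng x y] by simp

lemma ideal_rngI:
  fixes I :: "'a::comm_ring_1 set"
  assumes "0 \<in> I" "\<And>x y. x \<in> I \<Longrightarrow> y \<in> I \<Longrightarrow> x + y \<in> I" "\<And>r x. x \<in> I \<Longrightarrow> r * x \<in> I"
  shows "ideal I rng"
proof (rule idealI)
  show "ring (rng :: 'a ring)" by (rule ring_from_type_algebra)
  interpret cring "rng :: 'a ring" by (rule cring_from_type_algebra)
  show "subgroup I (add_monoid (rng :: 'a ring))"
  proof (rule add.subgroupI)
    fix a assume "a \<in> I"
    then have "- a \<in> I" using assms(3)[of a "- 1"] by simp
    moreover have "\<ominus>\<^bsub>rng\<^esub> a = - a" using minus_equality[of "- a" a] by simp
    ultimately show "\<ominus>\<^bsub>rng\<^esub> a \<in> I" by simp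
  qed (use assms in auto)
qed (use assms in \<open>auto simp: mult.commute\<close>)

section \<open>Discrete valuation rings\<close>

lemma dvr_ideal:
  assumes "dvr_with_maximal (P :: 'a::idom set)"
  shows "ideal P rng"
  using assms maximalideal.axioms(1) unfolding dvr_with_maximal_def by blast

lemma dvr_principal:
  assumes "dvr_with_maximal (P :: 'a::idom set)" and "ideal I (rng :: 'a ring)"
  obtains a where "I = {x. a dvd x}"
  using assms principal_domain.exists_gen cgenideal_rng unfolding dvr_with_maximal_def by metis

text \<open>A nonzero nonunit of a principal ideal domain has an irreducible divisor, which generates a maximal
  ideal; there is only one.\<close>

lemma dvr_nonunit_iff:
  fixes P :: "'a::idom set"
  assumes P: "dvr_with_maximal P"
  shows "x \<in> P \<longleftrightarrow> \<not> x dvd 1"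
proof
  interpret principal_domain "rng :: 'a ring" using P by (simp add: dvr_with_maximal_def)
  assume "x \<in> P"
  show "\<not> x dvd 1"
  proof
    assume "x dvd 1"
    then have "z \<in> P" for z
      using ideal_rng_mult[OF dvr_ideal[OF P] \<open>x \<in> P\<close>] by (metis dvdE dvd_trans mult.commute one_dvd)
    moreover have "maximalideal P (rng :: 'a ring)" using P by (simp add: dvr_with_maximal_def)
    ultimately show False using maximalideal.I_notcarr[of P rng] by auto
  qed
next
  interpret principal_domain "rng :: 'a ring" using P by (simp add: dvr_with_maximal_def)
  assume x: "\<not> x dvd 1"
  show "x \<in> P"
  proof (cases "x = 0")
    case True
    then show ?thesis using additive_subgroup.zero_closed[OF ideal.axioms(1)[OF dvr_ideal[OF P]]] by simp
  next
    case False
    then have "x \<in> carrier rng - {\<zero>\<^bsub>rng\<^esub>}" "x \<notin> Units rng" using x by (simp_all add: Units_rng)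
    then obtain b where irr: "ring_irreducible\<^bsub>rng\<^esub> b" and b: "b divides\<^bsub>rng\<^esub> x"
      by (rule exists_irreducible_divisor)
    have "maximalideal (PIdl\<^bsub>rng\<^esub> b) (rng :: 'a ring)"
      by (rule irreducible_imp_maximalideal[OF _ irr]) simp
    then have "PIdl\<^bsub>rng\<^esub> b = P" using P unfolding dvr_with_maximal_def by blast
    moreover have "b dvd x" using b by (auto simp: factor_def)
    ultimately show ?thesis by (auto simp: cgenideal_rng)
  qed
qed

text \<open>If all powers of \<open>t\<close> divided \<open>z \<noteq> 0\<close>, the quotients would generate an increasing chain of
  ideals; their union is principal, so the chain stops, and \<open>t\<close> is a unit.\<close>

lemma dvr_separated:
  fixes P :: "'a::idom set" and t z :: 'a
  assumes P: "dvr_with_maximal P" and t: "\<not> t dvd 1" and z: "\<And>k. t ^ k dvd z"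
  shows "z = 0"
proof (rule ccontr)
  assume "z \<noteq> 0"
  from z obtain q where q: "\<And>k. z = t ^ k * q k" unfolding dvd_def by metis
  have t0: "t \<noteq> 0" using q[of 1] \<open>z \<noteq> 0\<close> by auto
  have step: "q k = t * q (Suc k)" for k
  proof -
    have "t ^ k * (t * q (Suc k)) = t ^ Suc k * q (Suc k)" by (simp add: mult_ac)
    then have "t ^ k * q k = t ^ k * (t * q (Suc k))" using q by metis
    moreover have "t ^ k \<noteq> 0" using t0 by simp
    ultimately show ?thesis using mult_left_cancel by blast
  qed
  have chain: "q (k + m) dvd q k" for k m
    by (induction m) (auto intro: dvd_trans simp: step[of "k + _"])
  define I where "I = {x. \<exists>k. q k dvd x}"
  have "ideal I rng"
  proof (rule ideal_rngI)
    fix x y assume "x \<in> I" "y \<in> I"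
    then obtain k m where "q k dvd x" "q m dvd y" by (auto simp: I_def)
    then have "q (k + m) dvd x" "q (k + m) dvd y"
      using chain[of k m] chain[of m k] by (auto intro: dvd_trans simp: add.commute)
    then show "x + y \<in> I" unfolding I_def using dvd_add by blast
  qed (auto simp: I_def intro: dvd_mult)
  with P obtain d where d: "I = {x. d dvd x}" by (rule dvr_principal)
  then have "d \<in> I" by simp
  then obtain k where "q k dvd d" unfolding I_def by auto
  moreover have "q (Suc k) \<in> I" unfolding I_def by (blast intro: dvd_refl)
  then have "d dvd q (Suc k)" using d by simp
  ultimately have "t * q (Suc k) dvd 1 * q (Suc k)" using step[of k] dvd_trans by force
  moreover have "q (Suc k) \<noteq> 0" using q[of "Suc k"] \<open>z \<noteq> 0\<close> by auto
  ultimately show False using t dvd_mult_cancel_right by blast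
qed

text \<open>The ideal powers of a principal ideal are generated by the powers of the generator, so the adic
  topology can be handled by divisibility alone.\<close>

lemma ideal_power_principal:
  fixes t :: "'a::comm_ring_1"
  shows "ideal_power {x. t dvd x} k = {x. t ^ k dvd x}"
proof (induction k)
  case (Suc k)
  have "ideal_prod rng {x. t dvd x} {x. t ^ k dvd x} = {x. t ^ Suc k dvd x}"
  proof (intro equalityI subsetI)
    fix x assume "x \<in> ideal_prod rng {x. t dvd x} {x. t ^ k dvd x}"
    then show "x \<in> {x. t ^ Suc k dvd x}"
      by (induction rule: ideal_prod.induct) (auto intro: mult_dvd_mono)
  next
    fix x assume "x \<in> {x. t ^ Suc k dvd x}"
    then obtain r where "x = t * (t ^ k * r)" by (auto simp: mult.assoc)
    then show "x \<in> ideal_prod rng {x. t dvd x} {x. t ^ k dvd x}"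
      using ideal_prod.prod[of t "{x. t dvd x}" "t ^ k * r" "{x. t ^ k dvd x}" rng] by simp
  qed
  then show ?case using Suc by (simp add: ideal_power_def)
qed (simp add: ideal_power_def)

text \<open>The residue field enters as a ring isomorphic to the quotient; composing with the
  projection gives an honest homomorphism of type-class rings.\<close>

lemma residue_hom:
  fixes P :: "'a::comm_ring_1 set"
  assumes P: "ideal P rng" and iso: "(rng :: 'a ring) Quot P \<simeq> (rng :: 'k::comm_ring_1 ring)"
  obtains \<phi> :: "'a \<Rightarrow> 'k::comm_ring_1" where "comm_ring_hom \<phi>" and "\<And>x. \<phi> x = 0 \<longleftrightarrow> x \<in> P"
proof -
  interpret ideal P "rng :: 'a ring" by (rule P)
  obtain h where h: "h \<in> ring_iso ((rng :: 'a ring) Quot P) (rng :: 'k ring)"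
    using iso unfolding is_ring_iso_def by auto
  define \<phi> where "\<phi> x = h (P +>\<^bsub>rng\<^esub> x)" for x
  have hom: "\<phi> \<in> Ring.ring_hom (rng :: 'a ring) (rng :: 'k ring)"
    using ring_hom_trans[OF rcos_ring_hom, of h rng] h
    by (simp add: ring_iso_def \<phi>_def[abs_def] comp_def)
  have add: "\<phi> (x + y) = \<phi> x + \<phi> y" for x y using ring_hom_add[OF hom, of x y] by simp
  have zero: "\<phi> 0 = 0" using add[of 0 0] by simp
  have "comm_ring_hom \<phi>"
    by unfold_locales (use add zero ring_hom_one[OF hom] ring_hom_mult[OF hom] in auto)
  moreover have "\<phi> x = 0 \<longleftrightarrow> x \<in> P" for x
  proof -
    have c: "P +>\<^bsub>rng\<^esub> y \<in> carrier ((rng :: 'a ring) Quot P)" for y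
      using ring_hom_closed[OF rcos_ring_hom, of y] by simp
    have "\<phi> x = 0 \<longleftrightarrow> h (P +>\<^bsub>rng\<^esub> x) = h (P +>\<^bsub>rng\<^esub> 0)" using zero by (simp add: \<phi>_def)
    also have "\<dots> \<longleftrightarrow> P +>\<^bsub>rng\<^esub> x = P +>\<^bsub>rng\<^esub> 0"
      using h c by (auto simp: ring_iso_def bij_betw_def inj_on_def)
    also have "\<dots> \<longleftrightarrow> x \<in> P"
      using quotient_eq_iff_same_a_r_cos[OF P, of x 0] by (simp add: a_minus_rng)
    finally show ?thesis .
  qed
  ultimately show thesis by (rule that)
qed

text \<open>Let \<open>t\<close> generate the maximal ideal. As \<open>N\<close> is a unit, \<open>y \<mapsto> y + (x - y\<^sup>N) / N\<close>
  contracts \<open>1 + t R\<close>, because its difference quotient is \<open>1 - (\<Sum>i<N. y\<^sup>i y'\<^sup>N\<^sup>-\<^sup>1\<^sup>-\<^sup>i) / N\<close>, which \<open>t\<close> divides; its fixed point is the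
  root.\<close>

lemma power_root_near_one:
  fixes P :: "'a::idom set"
  assumes P: "dvr_with_maximal P" and complete: "adically_complete P"
    and N: "of_nat N dvd (1 :: 'a)" and x: "x - 1 \<in> P"
  obtains y where "y ^ N = x"
proof -
  obtain t where t: "P = {x. t dvd x}" using dvr_principal[OF P dvr_ideal[OF P]] .
  have nt: "\<not> t dvd 1" using dvr_nonunit_iff[OF P, of t] t by auto
  obtain v :: 'a where v: "of_nat N * v = 1" using N by (auto simp: dvd_def)
  define g where "g y = y + v * (x - y ^ N)" for y
  have tx: "t dvd x - 1" using x t by simp
  have pow1: "t dvd y ^ i - 1" if "t dvd y - 1" for y i
    using that by (metis dvd_trans power_diff_1_eq dvd_triv_left)
  have contract: "t ^ Suc k dvd g y - g z"
    if y: "t dvd y - 1" and z: "t dvd z - 1" and yz: "t ^ k dvd y - z" for y z k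
  proof -
    define s where "s = (\<Sum>i<N. y ^ i * z ^ (N - Suc i))"
    have pow: "y ^ N - z ^ N = (y - z) * s"
      unfolding s_def by (subst power_diff_sumr2) (simp add: mult_ac)
    have "g y - g z = (y - z) - v * (y ^ N - z ^ N)" by (simp add: g_def algebra_simps)
    also have "\<dots> = (y - z) * (1 - v * s)" unfolding pow by (simp add: algebra_simps)
    also have "1 - v * s = v * (of_nat N - s)" using v by (simp add: algebra_simps)
    also have "of_nat N - s = (\<Sum>i<N. 1 - y ^ i * z ^ (N - Suc i))"
      by (simp add: s_def sum_subtractf)
    finally have eq: "g y - g z = (y - z) * (v * (\<Sum>i<N. 1 - y ^ i * z ^ (N - Suc i)))" .
    have "t dvd 1 - y ^ i * z ^ j" for i j
    proof -
      have eq: "1 - y ^ i * z ^ j = - ((y ^ i - 1) * z ^ j + (z ^ j - 1))" by (simp add: algebra_simps)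
      show ?thesis unfolding eq dvd_minus_iff by (intro dvd_add dvd_mult2 pow1 y z)
    qed
    then have "t dvd v * (\<Sum>i<N. 1 - y ^ i * z ^ (N - Suc i))" by (intro dvd_mult dvd_sum) auto
    then show ?thesis using yz eq by (simp add: mult_dvd_mono mult.commute[of t])
  qed
  define Y where "Y k = (g ^^ k) 1" for k
  have Y0: "t dvd Y k - 1" for k
  proof (induction k)
    case (Suc k)
    have "Y (Suc k) - 1 = (Y k - 1) + v * ((x - 1) - (Y k ^ N - 1))"
      by (simp add: Y_def g_def algebra_simps)
    then show ?case using Suc tx pow1[OF Suc, of N] by (metis dvd_add dvd_mult dvd_diff)
  qed (simp add: Y_def)
  have Ystep: "t ^ k dvd Y (Suc k) - Y k" for k
  proof (induction k)
    case (Suc k)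
    have "Y (Suc (Suc k)) - Y (Suc k) = g (Y (Suc k)) - g (Y k)" by (simp add: Y_def)
    then show ?case using contract[OF Y0 Y0 Suc] by simp
  qed simp
  have Yinc: "t ^ k dvd Y (k + m) - Y k" for k m
  proof (induction m)
    case (Suc m)
    have "t ^ k dvd Y (Suc (k + m)) - Y (k + m)"
      using Ystep[of "k + m"] by (metis dvd_trans le_add1 le_imp_power_dvd)
    from dvd_add[OF this Suc] show ?case by simp
  qed simp
  have cauchy: "\<forall>k. \<exists>m. \<forall>i\<ge>m. \<forall>j\<ge>m. Y i - Y j \<in> ideal_power P k"
  proof (intro allI exI impI)
    fix k i j :: nat assume "k \<le> i" "k \<le> j"
    then have "t ^ k dvd (Y i - Y k) - (Y j - Y k)"
      using dvd_diff[OF Yinc[of k "i - k"] Yinc[of k "j - k"]] by simp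
    then show "Y i - Y j \<in> ideal_power P k" by (simp add: t ideal_power_principal)
  qed
  then obtain l where l: "\<And>k. \<exists>m. \<forall>i\<ge>m. Y i - l \<in> ideal_power P k"
    using complete unfolding adically_complete_def by blast
  have lim: "\<exists>i\<ge>k. t ^ k dvd Y i - l" for k
    using l[of k] by (metis (no_types, lifting) t ideal_power_principal mem_Collect_eq nat_le_linear)
  obtain i where "t dvd Y i - l" using lim[of 1] by auto
  then have l1: "t dvd l - 1" using dvd_diff[OF Y0[of i]] by fastforce
  have "g l - l = 0"
  proof (rule dvr_separated[OF P nt])
    fix k
    obtain i where i: "i \<ge> k" "t ^ k dvd Y i - l" using lim by blast
    have "t ^ k dvd g (Y i) - g l" using contract[OF Y0 l1 i(2)] by (auto intro: dvd_trans[rotated])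
    moreover have "t ^ k dvd Y (Suc i) - Y i" using Ystep[of i] i(1) by (metis dvd_trans le_imp_power_dvd)
    moreover have "Y (Suc i) = g (Y i)" by (simp add: Y_def)
    moreover have "g l - l = (Y i - l) + (g (Y i) - Y i) - (g (Y i) - g l)" by simp
    ultimately show "t ^ k dvd g l - l" using i(2) by (metis dvd_add dvd_diff)
  qed
  then have "v * (x - l ^ N) = 0" by (simp add: g_def)
  then show thesis using that[of l] v by auto
qed

section \<open>Volume forms on a free algebra\<close>

lemma comm_ring_hom_structure_map:
  assumes "comm_algebra scale"
  shows "comm_ring_hom (\<lambda>r. scale r 1)"
proof -
  interpret Mod: Modules.module scale using assms by (simp add: comm_algebra_def)
  have "scale r 1 * scale s 1 = scale (r * s) 1" for r s
    using assms by (simp add: comm_algebra_def)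
  then show ?thesis by unfold_locales (simp_all add: Mod.scale_left_distrib)
qed

text \<open>The basis is a list, so that coordinates and matrices are indexed by positions.\<close>

locale free_algebra =
  fixes scale :: "'r::idom \<Rightarrow> 'a::idom \<Rightarrow> 'a" and es :: "'a list"
  assumes alg: "comm_algebra scale"
    and distinct_basis: "distinct es"
    and independent_basis: "\<not> Modules.module.dependent scale (set es)"
    and span_basis: "Modules.module.span scale (set es) = UNIV"
begin

sublocale Mod: Modules.module scale using alg by (simp add: comm_algebra_def)

sublocale incl: comm_ring_hom "\<lambda>r. scale r 1" by (rule comm_ring_hom_structure_map[OF alg])

lemma scale_conv_mult: "scale r x = scale r 1 * x"
  using alg unfolding comm_algebra_def by simp

abbreviation rank :: nat where "rank \<equiv> length es"

definition coord :: "'a \<Rightarrow> nat \<Rightarrow> 'r" where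
  "coord x j = Mod.representation (set es) x (es ! j)"

lemma coord_add: "coord (x + y) j = coord x j + coord y j"
  by (simp add: coord_def Mod.representation_add[OF independent_basis] span_basis)

lemma coord_diff: "coord (x - y) j = coord x j - coord y j"
  by (simp add: coord_def Mod.representation_diff[OF independent_basis] span_basis)

lemma coord_scale: "coord (scale r x) j = r * coord x j"
  by (simp add: coord_def Mod.representation_scale[OF independent_basis] span_basis)

lemma coord_sum: "coord (\<Sum>i\<in>I. f i) j = (\<Sum>i\<in>I. coord (f i) j)"
  by (simp add: coord_def Mod.representation_sum[OF independent_basis] span_basis)

lemma coord_basis: "i < rank \<Longrightarrow> j < rank \<Longrightarrow> coord (es ! i) j = (if i = j then 1 else 0)"
  using distinct_basis
  by (simp add: coord_def Mod.representation_basis[OF independent_basis] nth_eq_iff_index_eq)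

lemma coord_expand: "(\<Sum>j<rank. scale (coord x j) (es ! j)) = x"
proof -
  have "(\<Sum>b\<in>set es. scale (Mod.representation (set es) x b) b) = x"
    by (rule Mod.sum_representation_eq[OF independent_basis]) (auto simp: span_basis)
  moreover have "bij_betw ((!) es) {..<rank} (set es)"
    by (rule bij_betw_nth[OF distinct_basis]) auto
  ultimately show ?thesis
    by (simp add: coord_def sum.reindex_bij_betw[symmetric])
qed

definition coord_mat :: "'a list \<Rightarrow> 'r mat" where
  "coord_mat xs = mat rank rank (\<lambda>(i, j). coord (xs ! i) j)"

definition volume :: "'a list \<Rightarrow> 'r" where
  "volume xs = det (coord_mat xs)"

lemma coord_mat_carrier [simp]: "coord_mat xs \<in> carrier_mat rank rank"
  by (simp add: coord_mat_def)

lemma volume_basis: "volume es = 1"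
proof -
  have "coord_mat es = 1\<^sub>m rank" by (rule eq_matI) (auto simp: coord_mat_def coord_basis)
  then show ?thesis by (simp add: volume_def)
qed

text \<open>Laplace expansion along the changed row. Its cofactors do not involve that row, so the volume is
  linear in each argument.\<close>

lemma volume_update:
  assumes i: "i < rank" and xs: "length xs = rank"
  shows "volume (xs[i := x]) = (\<Sum>j<rank. coord x j * cofactor (coord_mat xs) i j)"
proof -
  have "mat_delete (coord_mat (xs[i := x])) i j = mat_delete (coord_mat xs) i j" for j
    using i xs by (auto simp: mat_delete_def coord_mat_def intro!: eq_matI)
  then show ?thesis
    unfolding volume_def using i xs
    by (subst laplace_expansion_row[OF coord_mat_carrier i])
       (auto simp: cofactor_def coord_mat_def intro!: sum.cong)
qed

lemma volume_add:
  "i < rank \<Longrightarrow> length xs = rank \<Longrightarrow> volume (xs[i := x + y]) = volume (xs[i := x]) + volume (xs[i := y])"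
  by (simp add: volume_update coord_add distrib_right sum.distrib)

lemma volume_scale:
  "i < rank \<Longrightarrow> length xs = rank \<Longrightarrow> volume (xs[i := scale r x]) = r * volume (xs[i := x])"
  by (simp add: volume_update coord_scale sum_distrib_left mult.assoc)

lemma volume_alternating:
  "length xs = rank \<Longrightarrow> i < j \<Longrightarrow> j < rank \<Longrightarrow> xs ! i = xs ! j \<Longrightarrow> volume xs = 0"
  unfolding volume_def
  by (rule det_identical_rows[OF coord_mat_carrier, of i j]) (auto simp: coord_mat_def intro!: eq_vecI)

lemma volume_transition:
  assumes T: "T \<in> carrier_mat rank rank"
    and xs: "\<And>i. i < rank \<Longrightarrow> xs ! i = (\<Sum>j<rank. scale (T $$ (i, j)) (ys ! j))"
  shows "volume xs = det T * volume ys"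
proof -
  have "coord_mat xs = T * coord_mat ys"
    using T by (intro eq_matI)
      (auto simp: coord_mat_def xs coord_sum coord_scale scalar_prod_def lessThan_atLeast0 intro!: sum.cong)
  then show ?thesis by (simp add: volume_def det_mult[OF T])
qed

text \<open>Every element is integral of degree \<open>rank\<close>: multiplication by \<open>x\<close> has a matrix \<open>B\<close> with
  entries in the base ring, and the vector of basis elements lies in the kernel of \<open>x - B\<close>. Over
  the domain \<open>A\<close> the determinant of \<open>x - B\<close>, the characteristic polynomial of \<open>B\<close> at \<open>x\<close>, is
  therefore zero.\<close>

lemma integral_equation:
  obtains q where "Polynomial.degree q = rank" and "Polynomial.lead_coeff q = 1"
    and "poly (map_poly (\<lambda>r. scale r 1) q) x = 0"
proof -
  let ?\<iota> = "\<lambda>r. scale r 1"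
  define B where "B = mat rank rank (\<lambda>(i, j). coord (x * es ! i) j)"
  have B: "B \<in> carrier_mat rank rank" by (simp add: B_def)
  define C where "C = mat rank rank (\<lambda>(i, j). (if i = j then x else 0) - ?\<iota> (B $$ (i, j)))"
  define e where "e = vec rank (\<lambda>i. es ! i)"
  have C: "C \<in> carrier_mat rank rank" by (simp add: C_def)
  have "e \<noteq> 0\<^sub>v rank"
  proof
    assume "e = 0\<^sub>v rank"
    then have "es ! j = 0" if "j < rank" for j
      using that by (metis e_def index_vec index_zero_vec(1))
    then have "(1 :: 'a) = 0" using coord_expand[of 1] by simp
    then show False by simp
  qed
  moreover have "C *\<^sub>v e = 0\<^sub>v rank"
  proof (rule eq_vecI)
    fix i assume "i < dim_vec (0\<^sub>v rank :: 'a vec)"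
    then have i: "i < rank" by simp
    have "(C *\<^sub>v e) $ i = (\<Sum>j<rank. ((if i = j then x else 0) - ?\<iota> (B $$ (i, j))) * es ! j)"
      using i by (simp add: C_def e_def scalar_prod_def lessThan_atLeast0)
    also have "\<dots> = (\<Sum>j<rank. if i = j then x * es ! j else 0) - (\<Sum>j<rank. scale (coord (x * es ! i) j) (es ! j))"
      using i unfolding sum_subtractf[symmetric]
      by (intro sum.cong) (auto simp: left_diff_distrib B_def simp flip: scale_conv_mult)
    also have "\<dots> = 0" using i by (simp add: coord_expand)
    finally show "(C *\<^sub>v e) $ i = 0\<^sub>v rank $ i" using i by simp
  qed (simp add: C_def)
  moreover have "e \<in> carrier_vec rank" by (simp add: e_def)
  ultimately have "det C = 0" using det_0_iff_vec_prod_zero[OF C] by blast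
  moreover have "poly (char_poly (map_mat ?\<iota> B)) x = det C"
    unfolding char_poly_def
    by (rule poly_det_cong[OF C]) (auto simp: char_poly_matrix_def C_def B_def)
  ultimately have "poly (map_poly ?\<iota> (char_poly B)) x = 0"
    by (simp add: incl.char_poly_hom[OF B])
  then show thesis using degree_monic_char_poly[OF B] by (intro that) auto
qed

text \<open>Division by the monic integral equation of \<open>\<beta>\<close> leaves a remainder of degree below \<open>rank\<close>.\<close>

lemma adjoin_eq_span_powers:
  assumes "x \<in> adjoin scale \<beta>"
  obtains c where "x = (\<Sum>i<rank. scale (c i) (\<beta> ^ i))"
proof -
  interpret incl_poly: map_poly_comm_ring_hom "\<lambda>r. scale r 1" ..
  obtain f where f: "x = poly (map_poly (\<lambda>r. scale r 1) f) \<beta>"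
    using assms by (auto simp: adjoin_def)
  obtain g where g: "Polynomial.degree g = rank" "Polynomial.lead_coeff g = 1"
      "poly (map_poly (\<lambda>r. scale r 1) g) \<beta> = 0"
    by (rule integral_equation)
  obtain q r where qr: "pseudo_divmod f g = (q, r)" by (cases "pseudo_divmod f g")
  have "g \<noteq> 0" using g by auto
  \<comment> \<open>\<open>g\<close> is monic, so pseudo-division is honest division.\<close>
  then have fqr: "f = g * q + r" and r: "r = 0 \<or> Polynomial.degree r < rank"
    using pseudo_divmod[OF _ qr] g by simp_all
  have deg: "Polynomial.coeff r i = 0" if "i \<ge> rank" for i
    using r that by (auto intro: coeff_eq_0)
  have "x = poly (map_poly (\<lambda>r. scale r 1) r) \<beta>" by (simp add: f fqr hom_distribs g(3))
  also have "\<dots> = (\<Sum>i\<le>Polynomial.degree (map_poly (\<lambda>r. scale r 1) r). scale (Polynomial.coeff r i) (\<beta> ^ i))"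
    by (simp add: poly_altdef coeff_map_poly flip: scale_conv_mult)
  also have "\<dots> = (\<Sum>i<rank. scale (Polynomial.coeff r i) (\<beta> ^ i))"
  proof (rule sum.mono_neutral_cong)
    fix i assume "i \<in> {..<rank} - {..Polynomial.degree (map_poly (\<lambda>r. scale r 1) r)}"
    then have "Polynomial.coeff (map_poly (\<lambda>r. scale r 1) r) i = 0" by (intro coeff_eq_0) simp
    then show "scale (Polynomial.coeff r i) (\<beta> ^ i) = 0"
      by (simp add: coeff_map_poly scale_conv_mult[of _ "\<beta> ^ i"])
  qed (auto simp: deg)
  finally show thesis by (rule that)
qed

end

definition powers :: "nat \<Rightarrow> 'a::monoid_mult \<Rightarrow> 'a list" where
  "powers n x = map (\<lambda>i. x ^ i) [0..<n]"

lemma powers_simps [simp]: "length (powers n x) = n" "i < n \<Longrightarrow> powers n x ! i = x ^ i"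
  by (simp_all add: powers_def)

text \<open>The powers of a generator span, so the volume of the old basis, which is \<open>1\<close>, is a multiple of
  their volume.\<close>

lemma (in free_algebra) volume_powers_unit:
  assumes "adjoin scale \<beta> = UNIV"
  shows "volume (powers rank \<beta>) dvd 1"
proof -
  have "\<exists>c. es ! i = (\<Sum>j<rank. scale (c j) (\<beta> ^ j))" for i
    using adjoin_eq_span_powers[of "es ! i" \<beta>] assms by blast
  then obtain c where c: "\<And>i. es ! i = (\<Sum>j<rank. scale (c i j) (\<beta> ^ j))" by metis
  have "volume es = det (mat rank rank (\<lambda>(i, j). c i j)) * volume (powers rank \<beta>)"
    by (rule volume_transition) (auto simp: c[of "_ :: nat"] intro!: sum.cong)
  then show ?thesis by (metis volume_basis dvd_triv_right)
qed

text \<open>The coordinate matrix of the powers has nonzero determinant, so a linear relation between them is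
  trivial.\<close>

lemma (in free_algebra) free_algebra_powers:
  assumes gen: "adjoin scale \<beta> = UNIV"
  shows "free_algebra scale (powers rank \<beta>)"
proof -
  have unit: "volume (powers rank \<beta>) \<noteq> 0" using volume_powers_unit[OF gen] by auto
  have inj: "inj_on (\<lambda>i. \<beta> ^ i) {..<rank}"
  proof (rule linorder_inj_onI')
    fix i j assume "i \<in> {..<rank}" "j \<in> {..<rank}" "i < j"
    then show "\<beta> ^ i \<noteq> \<beta> ^ j" using volume_alternating[of "powers rank \<beta>" i j] unit by auto
  qed
  have set: "set (powers rank \<beta>) = (\<lambda>i. \<beta> ^ i) ` {..<rank}" by (auto simp: powers_def)
  have "\<not> Mod.dependent (set (powers rank \<beta>))"
  proof
    assume "Mod.dependent (set (powers rank \<beta>))"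
    then obtain u i where i: "i < rank" "u (\<beta> ^ i) \<noteq> 0" and "(\<Sum>v\<in>set (powers rank \<beta>). scale (u v) v) = 0"
      by (auto simp: Mod.dependent_finite set)
    then have zero: "(\<Sum>j<rank. scale (u (\<beta> ^ j)) (\<beta> ^ j)) = 0"
      by (simp add: set sum.reindex[OF inj])
    let ?A = "transpose_mat (coord_mat (powers rank \<beta>))" and ?u = "vec rank (\<lambda>j. u (\<beta> ^ j))"
    have "?A *\<^sub>v ?u = 0\<^sub>v rank"
    proof (rule eq_vecI)
      fix k assume "k < dim_vec (0\<^sub>v rank :: 'r vec)"
      then have k: "k < rank" by simp
      have "(?A *\<^sub>v ?u) $ k = coord (\<Sum>j<rank. scale (u (\<beta> ^ j)) (\<beta> ^ j)) k"
        using k by (auto simp: coord_mat_def scalar_prod_def lessThan_atLeast0 coord_sum coord_scale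
            mult.commute intro!: sum.cong)
      then show "(?A *\<^sub>v ?u) $ k = 0\<^sub>v rank $ k"
        using k zero coord_diff[of 0 0] by simp
    qed (simp add: coord_mat_def)
    moreover have "?u \<noteq> 0\<^sub>v rank" using i by (metis index_vec index_zero_vec(1))
    ultimately have "det ?A = 0"
      using det_0_iff_vec_prod_zero[of ?A rank] by (metis coord_mat_carrier transpose_carrier_mat vec_carrier)
    then show False using unit by (simp add: volume_def det_transpose[OF coord_mat_carrier])
  qed
  moreover have "x \<in> Mod.span (set (powers rank \<beta>))" for x
  proof -
    obtain c where "x = (\<Sum>i<rank. scale (c i) (\<beta> ^ i))"
      using adjoin_eq_span_powers[of x \<beta>] gen by blast
    then show ?thesis
      by (simp only:) (rule Mod.span_sum, rule Mod.span_scale, rule Mod.span_base, simp add: set)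
  qed
  moreover have "distinct (powers rank \<beta>)"
    using inj by (simp add: powers_def distinct_map lessThan_atLeast0)
  ultimately show ?thesis by unfold_locales (use alg in auto)
qed

section \<open>The top exterior power\<close>

lemma lookup_free_scale: "Poly_Mapping.lookup (free_scale r x) k = r * Poly_Mapping.lookup x k"
  by (simp add: free_scale_def Poly_Mapping.map.rep_eq when_def)

lemma module_free_scale: "Modules.module free_scale"
  by (rule Modules.module.intro)
     (auto intro!: poly_mapping_eqI simp: lookup_free_scale lookup_add algebra_simps)

lemma refl_ext_rel: "x \<in> free_on_tuples n \<Longrightarrow> (x, x) \<in> ext_rel scale n"
  by (simp add: ext_rel_def Modules.module.span_zero[OF module_free_scale])

lemma single_in_free_on_tuples: "length xs = n \<Longrightarrow> Poly_Mapping.single xs r \<in> free_on_tuples n"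
  by (auto simp: free_on_tuples_def)

lemma wedge_in_ext_power: "length xs = n \<Longrightarrow> wedge scale xs \<in> ext_power scale n"
  unfolding wedge_def ext_power_def by (auto intro: quotientI single_in_free_on_tuples)

context free_algebra
begin

text \<open>The linear extension of the volume to the free module on lists. It kills the relations of
  multilinearity and alternation, and so descends to the exterior power.\<close>

definition volume_functional :: "('a list \<Rightarrow>\<^sub>0 'r) \<Rightarrow> 'r" where
  "volume_functional x = (\<Sum>k\<in>Poly_Mapping.keys x. Poly_Mapping.lookup x k * volume k)"

lemma volume_functional_superset:
  "finite S \<Longrightarrow> Poly_Mapping.keys x \<subseteq> S \<Longrightarrow>
   volume_functional x = (\<Sum>k\<in>S. Poly_Mapping.lookup x k * volume k)"
  unfolding volume_functional_def
  by (rule sum.mono_neutral_left) (auto simp: in_keys_iff)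

lemma volume_functional_diff:
  "volume_functional (x - y) = volume_functional x - volume_functional y"
proof -
  let ?S = "Poly_Mapping.keys x \<union> Poly_Mapping.keys y"
  have "Poly_Mapping.keys (x - y) \<subseteq> ?S" by (auto simp: in_keys_iff lookup_minus)
  then show ?thesis
    by (simp add: volume_functional_superset[of ?S] lookup_minus left_diff_distrib sum_subtractf)
qed

lemma volume_functional_scale: "volume_functional (free_scale r x) = r * volume_functional x"
proof -
  have "Poly_Mapping.keys (free_scale r x) \<subseteq> Poly_Mapping.keys x"
    by (auto simp: in_keys_iff lookup_free_scale)
  then show ?thesis
    by (simp add: volume_functional_superset[of "Poly_Mapping.keys x"] lookup_free_scale
        sum_distrib_left mult.assoc)
qed

lemma volume_functional_single: "volume_functional (Poly_Mapping.single xs r) = r * volume xs"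
  by (simp add: volume_functional_superset[of "{xs}"])

lemma volume_functional_ext_rel:
  assumes "(x, y) \<in> ext_rel scale rank"
  shows "volume_functional x = volume_functional y"
proof -
  interpret Free: Modules.module "free_scale :: 'r \<Rightarrow> ('a list \<Rightarrow>\<^sub>0 'r) \<Rightarrow> _" by (rule module_free_scale)
  have "x - y \<in> Free.span (wedge_relations scale rank)" using assms by (simp add: ext_rel_def)
  moreover have "Free.span (wedge_relations scale rank) \<subseteq> {x. volume_functional x = 0}"
  proof (rule Free.span_minimal)
    show "wedge_relations scale rank \<subseteq> {x. volume_functional x = 0}"
      by (auto simp: wedge_relations_def volume_functional_diff volume_functional_single
          volume_add volume_scale volume_alternating)
    have "volume_functional (x + y) = volume_functional x + volume_functional y" for x y
      using volume_functional_diff[of x "- y"] volume_functional_diff[of 0 y]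
      by (simp add: volume_functional_def)
    then show "Free.subspace {x. volume_functional x = 0}"
      by (auto simp: Free.subspace_def volume_functional_scale) (simp add: volume_functional_def)
  qed
  ultimately show ?thesis using volume_functional_diff[of x y] by auto
qed

text \<open>Here \<open>d\<close> is the value of the volume functional on \<open>\<omega>\<close>. The wedge of the basis is a multiple of \<open>\<omega>\<close>
  and has volume \<open>1\<close>, so \<open>d\<close> is a unit; cancelling it yields the uniqueness of the coefficient by
  which the index form is defined.\<close>

lemma orientation_index_form:
  assumes "orientation scale rank \<omega>"
  obtains d where "d dvd 1"
    and "\<And>\<beta>. index_form scale rank \<omega> \<beta> * d = volume (powers rank \<beta>)"
proof -
  from assms obtain x0 where x0: "x0 \<in> free_on_tuples rank" and \<omega>: "\<omega> = ext_rel scale rank `` {x0}"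
    by (auto simp: orientation_def ext_power_def elim: quotientE)
  define d where "d = volume_functional x0"
  have val: "c * d = volume xs"
    if len: "length xs = rank" and W: "wedge scale xs = ext_scale scale rank c \<omega>" for xs c
  proof -
    have "Poly_Mapping.single xs 1 \<in> wedge scale xs"
      using len by (simp add: wedge_def refl_ext_rel single_in_free_on_tuples)
    then obtain x where x: "x \<in> \<omega>" "(free_scale c x, Poly_Mapping.single xs 1) \<in> ext_rel scale rank"
      using W by (auto simp: ext_scale_def)
    have "volume_functional x = d"
      using x(1) volume_functional_ext_rel[of x0 x] by (simp add: \<omega> d_def)
    then show ?thesis
      using volume_functional_ext_rel[OF x(2)] by (simp add: volume_functional_scale volume_functional_single)
  qed
  have ex: "\<exists>c. wedge scale xs = ext_scale scale rank c \<omega>" if "length xs = rank" for xs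
    using assms wedge_in_ext_power[OF that] unfolding orientation_def by blast
  from ex[of es] val[of es] have "d dvd 1" by (auto simp: volume_basis) (metis dvd_triv_right)
  then have "d \<noteq> 0" by auto
  have "index_form scale rank \<omega> \<beta> * d = volume (powers rank \<beta>)" for \<beta>
  proof -
    obtain c where c: "wedge scale (powers rank \<beta>) = ext_scale scale rank c \<omega>" using ex[of "powers rank \<beta>"] by auto
    have "c' = c" if "wedge scale (powers rank \<beta>) = ext_scale scale rank c' \<omega>" for c'
      using val[OF _ c] val[OF _ that] mult_right_cancel[OF \<open>d \<noteq> 0\<close>, of c' c] by simp
    then have "index_form scale rank \<omega> \<beta> = c"
      unfolding index_form_def powers_def[symmetric] using c by (intro the_equality) auto
    then show ?thesis using val[OF _ c] by simp
  qed
  with \<open>d dvd 1\<close> show thesis by (rule that)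
qed

end

section \<open>Totally ramified extensions\<close>

text \<open>Coordinates are taken in the basis \<open>1, \<pi>, \<dots>, \<pi>\<^sup>n\<^sup>-\<^sup>1\<close>. That \<open>\<pi>\<close> both generates \<open>M\<close> and, as an
  algebra, \<open>A\<close> forces total ramification of degree \<open>n\<close>.\<close>

locale totally_ramified = free_algebra scale "powers n \<pi>"
  for scale :: "'r::idom \<Rightarrow> 'a::idom \<Rightarrow> 'a" and n :: nat and \<pi> :: 'a +
  fixes P :: "'r set" and M :: "'a set"
  assumes P: "dvr_with_maximal P" and M: "dvr_with_maximal M" and M_gen: "M = {x. \<pi> dvd x}"
    and gen: "adjoin scale \<pi> = UNIV"
begin

text \<open>The residue field extension is trivial: a polynomial in \<open>\<pi>\<close> is congruent to its constant term.\<close>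

lemma residue_representative:
  obtains r where "\<pi> dvd x - scale r 1"
proof -
  obtain q where "x = poly (map_poly (\<lambda>r. scale r 1) q) \<pi>"
    using gen by (auto simp: adjoin_def)
  then show thesis by (cases q) (auto simp: incl.map_poly_pCons_hom intro!: that[of "Polynomial.coeff q 0"])
qed

lemma incl_unit: "r dvd 1 \<Longrightarrow> scale r 1 dvd 1"
  using incl.hom_dvd[of r 1] by simp

text \<open>If \<open>r \<in> P\<close> were a unit of \<open>A\<close>, its inverse would be congruent to some \<open>s\<close> in \<open>R\<close>; then
  \<open>rs - 1\<close>, a unit of \<open>R\<close>, would lie in \<open>M\<close>.\<close>

lemma pi_dvd_incl_iff: "\<pi> dvd scale r 1 \<longleftrightarrow> r \<in> P"
proof
  assume "\<pi> dvd scale r 1"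
  then have "\<not> scale r 1 dvd 1" using dvr_nonunit_iff[OF M] M_gen by auto
  then show "r \<in> P" using incl_unit dvr_nonunit_iff[OF P] by blast
next
  assume r: "r \<in> P"
  show "\<pi> dvd scale r 1"
  proof (rule ccontr)
    assume "\<not> \<pi> dvd scale r 1"
    then have "scale r 1 dvd 1" using dvr_nonunit_iff[OF M] M_gen by auto
    then obtain z where z: "scale r 1 * z = 1" by (metis dvdE)
    obtain s where "\<pi> dvd z - scale s 1" by (rule residue_representative)
    then have "\<pi> dvd scale r 1 * (z - scale s 1)" by (rule dvd_mult)
    also have "scale r 1 * (z - scale s 1) = scale (1 - r * s) 1"
      by (simp add: right_diff_distrib z incl.hom_mult incl.hom_minus)
    finally have "\<pi> dvd scale (1 - r * s) 1" .
    then have "\<not> scale (1 - r * s) 1 dvd 1" using dvr_nonunit_iff[OF M] M_gen by auto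
    then have "1 - r * s \<in> P" using incl_unit dvr_nonunit_iff[OF P] by blast
    then have "(1 - r * s) + s * r \<in> P"
      using r by (intro ideal_rng_add[OF dvr_ideal[OF P]] ideal_rng_mult[OF dvr_ideal[OF P]])
    then show False using dvr_nonunit_iff[OF P, of 1] by (simp add: mult.commute)
  qed
qed

text \<open>The ramification index is at least \<open>n\<close>. If \<open>\<pi>\<^sup>i\<close> with \<open>i < n\<close> were a unit times the
  uniformizer \<open>t\<close> of \<open>R\<close>, then \<open>t\<close> would divide the \<open>i\<close>-th coordinate \<open>1\<close> of \<open>\<pi>\<^sup>i\<close>.\<close>

lemma pi_power_dvd_incl:
  assumes "r \<in> P"
  shows "\<pi> ^ n dvd scale r 1"
proof -
  obtain t where t: "P = {x. t dvd x}" using dvr_principal[OF P dvr_ideal[OF P]] .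
  have nt: "\<not> t dvd 1" using dvr_nonunit_iff[OF P, of t] t by auto
  have "\<pi> ^ i dvd scale t 1" if "i \<le> n" for i
    using that
  proof (induction i)
    case (Suc i)
    then obtain s where s: "scale t 1 = \<pi> ^ i * s" by (auto elim: dvdE)
    have "\<pi> dvd s"
    proof (rule ccontr)
      assume "\<not> \<pi> dvd s"
      then have "s dvd 1" using dvr_nonunit_iff[OF M] M_gen by auto
      then obtain z where "s * z = 1" by (metis dvdE)
      then have "\<pi> ^ i = scale t z"
        by (subst scale_conv_mult) (simp add: s mult.assoc)
      then have "coord (powers n \<pi> ! i) i = t * coord z i"
        using Suc.prems by (simp add: coord_scale)
      then have "1 = t * coord z i" using Suc.prems by (simp add: coord_basis del: powers_simps(2))
      then show False using nt by (metis dvd_triv_left)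
    qed
    then show ?case using s by (simp add: mult.commute[of \<pi>])
  qed simp
  then have "\<pi> ^ n dvd scale t 1" by simp
  moreover have "scale t 1 dvd scale r 1" using assms t incl.hom_dvd by auto
  ultimately show ?thesis by (rule dvd_trans)
qed

text \<open>Modulo \<open>P\<close> the algebra is \<open>k[x]/(x\<^sup>n)\<close>, with the coordinates for coefficients, and a multiple
  of \<open>x\<^sup>i\<close> has no terms of degree below \<open>i\<close>.\<close>

lemma coord_in_maximal:
  assumes "\<pi> ^ i dvd x" and "i \<le> n" and "j < i"
  shows "coord x j \<in> P"
  using assms
proof (induction i arbitrary: j)
  case (Suc i)
  have "\<pi> ^ i dvd x" using Suc.prems(1) by (metis dvd_trans le_imp_power_dvd le_Suc_eq le_refl)
  then have low: "coord x l \<in> P" if "l < i" for l using Suc that by simp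
  have n: "n = Suc i + (n - Suc i)" using Suc.prems by simp
  define z where "z = (\<Sum>l\<in>{Suc i..<n}. scale (coord x l) (\<pi> ^ (l - Suc i)))"
  have "x = (\<Sum>l<n. scale (coord x l) (\<pi> ^ l))" using coord_expand[of x] by simp
  also have "{..<n} = {..<i} \<union> ({i} \<union> {Suc i..<n})" using Suc.prems by auto
  also have "(\<Sum>l\<in>\<dots>. scale (coord x l) (\<pi> ^ l)) = (\<Sum>l<i. scale (coord x l) (\<pi> ^ l)) +
     (scale (coord x i) (\<pi> ^ i) + (\<Sum>l\<in>{Suc i..<n}. scale (coord x l) (\<pi> ^ l)))"
    by (subst sum.union_disjoint; (subst sum.union_disjoint)?) auto
  also have "(\<Sum>l\<in>{Suc i..<n}. scale (coord x l) (\<pi> ^ l)) = \<pi> ^ Suc i * z"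
    unfolding z_def sum_distrib_left
  proof (rule sum.cong)
    fix l assume "l \<in> {Suc i..<n}"
    then have "\<pi> ^ l = \<pi> ^ Suc i * \<pi> ^ (l - Suc i)" by (simp flip: power_add del: power_Suc)
    then show "scale (coord x l) (\<pi> ^ l) = \<pi> ^ Suc i * scale (coord x l) (\<pi> ^ (l - Suc i))"
      by (simp add: scale_conv_mult[of _ "_ ^ _"] scale_conv_mult[of _ "_ * _"] mult_ac)
  qed simp
  finally have x: "scale (coord x i) (\<pi> ^ i) = x - (\<Sum>l<i. scale (coord x l) (\<pi> ^ l)) - \<pi> ^ Suc i * z"
    by (simp add: algebra_simps)
  \<comment> \<open>The lower coordinates lie in \<open>P\<close>, so their terms are divisible by \<open>\<pi>\<^sup>n\<close> and do not
    interfere with comparing the coefficients of \<open>\<pi>\<^sup>i\<close>.\<close>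
  have "\<pi> ^ Suc i dvd scale (coord x l) (\<pi> ^ l)" if "l < i" for l
  proof -
    have "\<pi> ^ Suc i dvd \<pi> ^ n" using Suc.prems by (intro le_imp_power_dvd) simp
    also have "\<pi> ^ n dvd scale (coord x l) 1" by (rule pi_power_dvd_incl[OF low[OF that]])
    also have "\<dots> dvd scale (coord x l) (\<pi> ^ l)" by (subst (2) scale_conv_mult) simp
    finally show ?thesis .
  qed
  then have "\<pi> ^ Suc i dvd scale (coord x i) (\<pi> ^ i)"
    unfolding x using Suc.prems(1) by (intro dvd_diff dvd_sum) auto
  then have "\<pi> ^ i * \<pi> dvd \<pi> ^ i * scale (coord x i) 1"
    by (simp add: scale_conv_mult[of _ "_ ^ _"] mult.commute)
  moreover have "\<pi> \<noteq> 0" using M M_gen by (auto simp: dvr_with_maximal_def)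
  ultimately have "\<pi> dvd scale (coord x i) 1" by (subst (asm) dvd_mult_cancel_left) simp
  then have "coord x i \<in> P" by (simp add: pi_dvd_incl_iff)
  then show ?case using low Suc.prems(3) by (cases "j = i") auto
qed simp

text \<open>Translation changes the powers by a unipotent matrix of binomial coefficients.\<close>

lemma volume_powers_translate: "volume (powers n (x + scale a 1)) = volume (powers n x)"
proof -
  define T where "T = mat n n (\<lambda>(i, j). of_nat (i choose j) * a ^ (i - j) :: 'r)"
  have T: "T \<in> carrier_mat rank rank" by (simp add: T_def)
  have "volume (powers n (x + scale a 1)) = det T * volume (powers n x)"
  proof (rule volume_transition[OF T])
    fix i assume i: "i < rank"
    have "(x + scale a 1) ^ i = (\<Sum>j\<le>i. of_nat (i choose j) * x ^ j * scale a 1 ^ (i - j))"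
      by (rule binomial_ring)
    also have "\<dots> = (\<Sum>j\<le>i. scale (of_nat (i choose j) * a ^ (i - j)) (x ^ j))"
      by (subst scale_conv_mult) (simp add: incl.hom_mult incl.hom_power incl.hom_of_nat mult_ac)
    also have "\<dots> = (\<Sum>j<n. scale (of_nat (i choose j) * a ^ (i - j)) (x ^ j))"
    proof (rule sum.mono_neutral_left)
      show "\<forall>j\<in>{..<n} - {..i}. scale (of_nat (i choose j) * a ^ (i - j)) (x ^ j) = 0"
        by (simp add: binomial_eq_0)
    qed (use i in auto)
    finally show "powers n (x + scale a 1) ! i = (\<Sum>j<rank. scale (T $$ (i, j)) (powers n x ! j))"
      using i by (simp add: T_def)
  qed
  moreover have "det T = prod_list (diag_mat T)"
    by (rule det_lower_triangular[of n]) (auto simp: T_def binomial_eq_0)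
  moreover have "diag_mat T = replicate n 1"
    by (auto simp: diag_mat_def T_def intro!: nth_equalityI)
  ultimately show ?thesis by simp
qed

lemma volume_powers_scale: "volume (powers n (scale a x)) = a ^ (n * (n - 1) div 2) * volume (powers n x)"
proof -
  define T where "T = mat n n (\<lambda>(i, j). if i = j then a ^ i else 0)"
  have T: "T \<in> carrier_mat rank rank" by (simp add: T_def)
  have "volume (powers n (scale a x)) = det T * volume (powers n x)"
  proof (rule volume_transition[OF T])
    fix i assume i: "i < rank"
    have "(scale a x) ^ i = scale (a ^ i) (x ^ i)"
      by (subst (1 2) scale_conv_mult) (simp add: incl.hom_power power_mult_distrib)
    also have "\<dots> = (\<Sum>j<n. if i = j then scale (a ^ i) (x ^ j) else 0)" using i by simp
    also have "\<dots> = (\<Sum>j<n. scale (if i = j then a ^ i else 0) (x ^ j))"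
      by (intro sum.cong) auto
    finally show "powers n (scale a x) ! i = (\<Sum>j<rank. scale (T $$ (i, j)) (powers n x ! j))"
      using i by (simp add: T_def)
  qed
  moreover have "det T = prod_list (diag_mat T)"
    by (rule det_lower_triangular[of n]) (auto simp: T_def)
  moreover have "diag_mat T = map (\<lambda>i. a ^ i) [0..<n]"
    by (auto simp: diag_mat_def T_def intro!: nth_equalityI)
  moreover have "prod_list (map (\<lambda>i. a ^ i) [0..<n]) = a ^ (n * (n - 1) div 2)"
    by (simp add: prod.distinct_set_conv_list[symmetric] power_sum[symmetric] Sum_Ico_nat)
  ultimately show ?thesis by simp
qed

text \<open>A translate \<open>\<gamma>\<close> of \<open>\<beta>\<close> lies in \<open>M\<close>, say \<open>\<gamma> = a \<pi> + \<dots>\<close> up to higher powers of \<open>\<pi>\<close>. Then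
  \<open>\<gamma>\<^sup>i = a\<^sup>i \<pi>\<^sup>i + \<dots>\<close>, so modulo \<open>P\<close> the coordinate matrix of the powers of \<open>\<gamma>\<close> is triangular
  with diagonal \<open>1, a, \<dots>, a\<^sup>n\<^sup>-\<^sup>1\<close>.\<close>

lemma volume_powers_residue:
  assumes \<phi>: "comm_ring_hom \<phi>" and ker: "\<And>r. \<phi> r = 0 \<longleftrightarrow> r \<in> P"
  obtains a where "\<phi> (volume (powers n \<beta>)) = \<phi> a ^ (n * (n - 1) div 2)"
proof -
  interpret \<phi>: comm_ring_hom \<phi> by (rule \<phi>)
  obtain b where "\<pi> dvd \<beta> - scale b 1" by (rule residue_representative)
  then obtain w where w: "\<beta> - scale b 1 = \<pi> * w" by (auto elim: dvdE)
  obtain a where a: "\<pi> dvd w - scale a 1" by (rule residue_representative)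
  let ?\<gamma> = "\<pi> * w"
  have vol: "volume (powers n \<beta>) = volume (powers n ?\<gamma>)"
    using volume_powers_translate[of ?\<gamma> b] w by (simp add: algebra_simps)
  let ?A = "map_mat \<phi> (coord_mat (powers n ?\<gamma>))"
  have A: "?A \<in> carrier_mat n n" using coord_mat_carrier[of "powers n ?\<gamma>"] by simp
  have entry: "?A $$ (i, j) = \<phi> (coord (?\<gamma> ^ i) j)" if "i < n" "j < n" for i j
    using that by (simp add: coord_mat_def)
  have zero: "\<phi> (coord (?\<gamma> ^ i) j) = 0" if "j < i" "i < n" for i j
    unfolding ker by (rule coord_in_maximal[of i]) (use that in \<open>auto simp: power_mult_distrib\<close>)
  have "upper_triangular ?A"
    unfolding upper_triangular_def
  proof (intro allI impI)
    fix i j assume "i < dim_row ?A" "j < i"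
    then show "?A $$ (i, j) = 0" using A zero[of j i] entry[of i j] by simp
  qed
  then have "det ?A = prod_list (diag_mat ?A)" by (rule det_upper_triangular[OF _ A])
  also have "diag_mat ?A = map (\<lambda>i. \<phi> a ^ i) [0..<n]"
  proof (rule nth_equalityI)
    fix i assume "i < length (diag_mat ?A)"
    then have i: "i < n" using A by (simp add: diag_mat_def)
    have "\<pi> dvd w ^ i - scale a 1 ^ i"
      using a by (metis power_diff_sumr2 dvd_mult2)
    then have "\<pi> ^ i * \<pi> dvd \<pi> ^ i * (w ^ i - scale a 1 ^ i)" by (intro mult_dvd_mono) simp_all
    also have "\<pi> ^ i * (w ^ i - scale a 1 ^ i) = ?\<gamma> ^ i - scale (a ^ i) (\<pi> ^ i)"
      by (simp add: scale_conv_mult[of _ "_ ^ _"] incl.hom_power power_mult_distrib algebra_simps)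
    finally have "coord (?\<gamma> ^ i - scale (a ^ i) (\<pi> ^ i)) i \<in> P"
      using i by (intro coord_in_maximal[of "Suc i"]) (simp_all add: mult.commute)
    moreover have "coord (\<pi> ^ i) i = 1" using coord_basis[of i i] i by simp
    ultimately have "\<phi> (coord (?\<gamma> ^ i) i - a ^ i) = 0"
      by (simp add: ker coord_diff coord_scale)
    then show "diag_mat ?A ! i = map (\<lambda>i. \<phi> a ^ i) [0..<n] ! i"
      using i A entry[of i i] by (simp add: diag_mat_def \<phi>.hom_minus \<phi>.hom_power)
  qed (use A in \<open>simp add: diag_mat_def\<close>)
  also have "prod_list (map (\<lambda>i. \<phi> a ^ i) [0..<n]) = \<phi> a ^ (n * (n - 1) div 2)"
    by (simp add: prod.distinct_set_conv_list[symmetric] power_sum[symmetric] Sum_Ico_nat)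
  finally show thesis unfolding \<phi>.hom_det volume_def[symmetric] vol[symmetric] by (rule that)
qed

text \<open>With \<open>v w = 1\<close>, a polynomial in \<open>\<pi> = w (v \<pi>)\<close> is a polynomial in \<open>v \<pi>\<close>.\<close>

lemma adjoin_scale_generator:
  assumes "v dvd 1"
  shows "adjoin scale (scale v \<pi>) = UNIV"
proof -
  obtain w where w: "v * w = 1" using assms by (metis dvdE)
  have "\<exists>q'. poly (map_poly (\<lambda>r. scale r 1) q) \<pi> = poly (map_poly (\<lambda>r. scale r 1) q') (scale v \<pi>)" for q
  proof (induction q)
    case (pCons c q)
    then obtain q' where q': "poly (map_poly (\<lambda>r. scale r 1) q) \<pi> = poly (map_poly (\<lambda>r. scale r 1) q') (scale v \<pi>)"
      by blast
    have "scale v \<pi> * scale w 1 = \<pi>"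
      using w by (subst scale_conv_mult) (simp add: mult.commute mult.left_commute flip: incl.hom_mult)
    then have "poly (map_poly (\<lambda>r. scale r 1) (pCons c q)) \<pi> =
        poly (map_poly (\<lambda>r. scale r 1) (pCons c (Polynomial.smult w q'))) (scale v \<pi>)"
      by (simp add: incl.map_poly_pCons_hom incl.map_poly_hom_smult q' mult.assoc[symmetric])
    then show ?case by blast
  qed (rule exI[of _ 0], simp)
  then show ?thesis using gen unfolding adjoin_def by (auto simp: set_eq_iff image_iff) metis
qed

end

section \<open>Kummer torsors\<close>

definition kummer_poly :: "nat \<Rightarrow> 'r::comm_ring_1 \<Rightarrow> 'r poly" where
  "kummer_poly N u = Polynomial.monom 1 N - [:u:]"

definition kummer_coset :: "nat \<Rightarrow> 'r::comm_ring_1 \<Rightarrow> 'r poly \<Rightarrow> 'r poly set" where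
  "kummer_coset N u q = {p. kummer_poly N u dvd p - q}"

lemma kummer_ideal_eq: "kummer_ideal N u = {q. kummer_poly N u dvd q}"
  by (simp add: kummer_ideal_def kummer_poly_def cgenideal_rng)

lemma ideal_kummer_ideal: "ideal (kummer_ideal N u) rng"
  by (rule ideal_rngI) (auto simp: kummer_ideal_eq)

lemma a_r_coset_kummer: "kummer_ideal N u +>\<^bsub>rng\<^esub> q = kummer_coset N u q"
proof (intro equalityI subsetI)
  fix p assume "p \<in> kummer_coset N u q"
  then have "p - q \<in> kummer_ideal N u" by (simp add: kummer_coset_def kummer_ideal_eq)
  then have "(p - q) + q \<in> kummer_ideal N u +>\<^bsub>rng\<^esub> q" unfolding a_r_coset_def' by force
  then show "p \<in> kummer_ideal N u +>\<^bsub>rng\<^esub> q" by simp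
qed (auto simp: a_r_coset_def' kummer_coset_def kummer_ideal_eq)

lemma kummer_coset_eq_iff: "kummer_coset N u p = kummer_coset N u q \<longleftrightarrow> kummer_poly N u dvd p - q"
  using ring.quotient_eq_iff_same_a_r_cos[OF ring_from_type_algebra ideal_kummer_ideal, of p q N u]
  by (simp add: a_r_coset_kummer a_minus_rng) (simp add: kummer_ideal_eq)

text \<open>The operations of the torsor are unions over representatives; this evaluates such a union when the
  operation respects the congruence.\<close>

lemma Union_kummer_coset:
  assumes "\<And>x y. kummer_poly N u dvd x - y \<Longrightarrow> kummer_poly N' u' dvd F x - F y"
  shows "(\<Union>q\<in>kummer_coset N u p. kummer_coset N' u' (F q)) = kummer_coset N' u' (F p)"
proof -
  have "p \<in> kummer_coset N u p" by (simp add: kummer_coset_def)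
  moreover have "kummer_coset N' u' (F q) = kummer_coset N' u' (F p)" if "q \<in> kummer_coset N u p" for q
    using that assms by (simp add: kummer_coset_eq_iff) (simp add: kummer_coset_def)
  ultimately show ?thesis by blast
qed

lemma coeff_degree_part:
  "Polynomial.coeff (degree_part N i q) m = (if m mod N = i then Polynomial.coeff q m else 0)"
proof -
  have "Polynomial.coeff (degree_part N i q) m =
      (\<Sum>j \<in> {j. j \<le> Polynomial.degree q \<and> j mod N = i}. if j = m then Polynomial.coeff q j else 0)"
    by (simp add: degree_part_def coeff_sum)
  also have "\<dots> = (if m mod N = i then Polynomial.coeff q m else 0)"
    by (subst sum.delta) (auto simp: coeff_eq_0)
  finally show ?thesis .
qed

lemma degree_part_add: "degree_part N i (p + q) = degree_part N i p + degree_part N i q"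
  by (rule poly_eqI) (simp add: coeff_degree_part)

lemma degree_part_diff: "degree_part N i (p - q) = degree_part N i p - degree_part N i q"
  by (rule poly_eqI) (simp add: coeff_degree_part)

lemma degree_part_smult: "degree_part N i (Polynomial.smult r p) = Polynomial.smult r (degree_part N i p)"
  by (rule poly_eqI) (simp add: coeff_degree_part)

lemma degree_part_1: "degree_part N i 1 = (if i = 0 then 1 else 0)"
  by (rule poly_eqI) (auto simp: coeff_degree_part intro: Nat.gr0I)

lemma degree_part_monom:
  "j < N \<Longrightarrow> degree_part N i (Polynomial.monom r j) = (if i = j then Polynomial.monom r j else 0)"
  by (rule poly_eqI) (auto simp: coeff_degree_part)

lemma degree_part_degree_part:
  "degree_part N i (degree_part N j q) = (if i = j then degree_part N j q else 0)"
  by (rule poly_eqI) (auto simp: coeff_degree_part)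

lemma sum_degree_part: "N > 0 \<Longrightarrow> (\<Sum>i<N. degree_part N i q) = q"
  by (rule poly_eqI) (simp add: coeff_degree_part coeff_sum)

text \<open>Multiplication by \<open>y\<^sup>N - u\<close> respects the grading modulo \<open>N\<close>, so the coaction is well defined on
  the quotient.\<close>

lemma degree_part_kummer_poly_mult:
  "N > 0 \<Longrightarrow> degree_part N i (kummer_poly N u * q) = kummer_poly N u * degree_part N i q"
  by (rule poly_eqI)
     (auto simp: coeff_degree_part kummer_poly_def left_diff_distrib coeff_monom_mult le_mod_geq not_less)

text \<open>The grading of \<open>R[y]\<close> by degrees modulo \<open>N\<close> is multiplicative: in a product, degrees add.\<close>

lemma degree_part_mult:
  assumes i: "i < N"
  shows "degree_part N i (p * q) =
    (\<Sum>j<N. degree_part N j p * degree_part N ((i + N - j) mod N) q)"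
proof (rule poly_eqI)
  fix m
  have shift: "(m - a) mod N = (i + N - a mod N) mod N \<longleftrightarrow> m mod N = i" if "a \<le> m" for a
  proof -
    have "a mod N < N" using i by simp
    then have "i + N - a mod N + a = i + (N + (a - a mod N))"
      using mod_less_eq_dividend[of a N] by linarith
    also have "[\<dots> = i + (N + 0)] (mod N)"
      by (intro cong_add cong_refl) (simp add: Cong.cong_def minus_mod_eq_mult_div)
    finally have "[i + N - a mod N + a = i] (mod N)" by (simp add: Cong.cong_def)
    moreover have "[m - a = i + N - a mod N] (mod N) \<longleftrightarrow> [m - a + a = i + N - a mod N + a] (mod N)"
      by (rule cong_add_rcancel_nat[symmetric])
    ultimately have "[m - a = i + N - a mod N] (mod N) \<longleftrightarrow> [m = i] (mod N)"
      using that by (simp add: Cong.cong_def)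
    then show ?thesis using i by (simp add: Cong.cong_def)
  qed
  have "Polynomial.coeff (\<Sum>j<N. degree_part N j p * degree_part N ((i + N - j) mod N) q) m =
      (\<Sum>j<N. \<Sum>a\<le>m. if a mod N = j then
         Polynomial.coeff p a * (if (m - a) mod N = (i + N - a mod N) mod N then Polynomial.coeff q (m - a) else 0) else 0)"
    by (auto simp: coeff_sum Polynomial.coeff_mult coeff_degree_part intro!: sum.cong)
  also have "\<dots> = (\<Sum>a\<le>m. \<Sum>j<N. if a mod N = j then
         Polynomial.coeff p a * (if (m - a) mod N = (i + N - a mod N) mod N then Polynomial.coeff q (m - a) else 0) else 0)"
    by (rule sum.swap)
  also have "\<dots> = (\<Sum>a\<le>m. if m mod N = i then Polynomial.coeff p a * Polynomial.coeff q (m - a) else 0)"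
    using i by (intro sum.cong) (auto simp: shift)
  also have "\<dots> = Polynomial.coeff (degree_part N i (p * q)) m"
    by (simp add: coeff_degree_part Polynomial.coeff_mult)
  finally show "Polynomial.coeff (degree_part N i (p * q)) m =
      Polynomial.coeff (\<Sum>j<N. degree_part N j p * degree_part N ((i + N - j) mod N) q) m" ..
qed

lemma kummer_torsor_simps:
  shows carrier_kummer: "carrier (kummer_torsor N u) = range (kummer_coset N u)"
    and mult_kummer: "kummer_coset N u p \<otimes>\<^bsub>kummer_torsor N u\<^esub> kummer_coset N u q = kummer_coset N u (p * q)"
    and add_kummer: "kummer_coset N u p \<oplus>\<^bsub>kummer_torsor N u\<^esub> kummer_coset N u q = kummer_coset N u (p + q)"
    and one_kummer: "\<one>\<^bsub>kummer_torsor N u\<^esub> = kummer_coset N u 1"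
    and zero_kummer: "\<zero>\<^bsub>kummer_torsor N u\<^esub> = kummer_coset N u 0"
    and smult_kummer: "r \<odot>\<^bsub>kummer_torsor N u\<^esub> kummer_coset N u p = kummer_coset N u (Polynomial.smult r p)"
    and coact_kummer: "N > 0 \<Longrightarrow> coact (kummer_torsor N u) i (kummer_coset N u p) = kummer_coset N u (degree_part N i p)"
proof -
  interpret ideal "kummer_ideal N u" "rng :: 'a poly ring" by (rule ideal_kummer_ideal)
  note hom = rcos_ring_hom
  note defs = kummer_torsor_def Let_def
  show "carrier (kummer_torsor N u) = range (kummer_coset N u)"
    by (auto simp: defs FactRing_def A_RCOSETS_def' a_r_coset_kummer)
  show "kummer_coset N u p \<otimes>\<^bsub>kummer_torsor N u\<^esub> kummer_coset N u q = kummer_coset N u (p * q)"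
    using ring_hom_mult[OF hom, of p q] by (simp add: defs a_r_coset_kummer)
  show "kummer_coset N u p \<oplus>\<^bsub>kummer_torsor N u\<^esub> kummer_coset N u q = kummer_coset N u (p + q)"
    using ring_hom_add[OF hom, of p q] by (simp add: defs a_r_coset_kummer)
  show "\<one>\<^bsub>kummer_torsor N u\<^esub> = kummer_coset N u 1"
    using ring_hom_one[OF hom] by (simp add: defs a_r_coset_kummer)
  show "\<zero>\<^bsub>kummer_torsor N u\<^esub> = kummer_coset N u 0"
    by (simp add: defs FactRing_def kummer_coset_def kummer_ideal_eq)
  show "r \<odot>\<^bsub>kummer_torsor N u\<^esub> kummer_coset N u p = kummer_coset N u (Polynomial.smult r p)"
    by (simp add: defs a_r_coset_kummer)
       (rule Union_kummer_coset, simp add: dvd_smult flip: smult_diff_right)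
  show "coact (kummer_torsor N u) i (kummer_coset N u p) = kummer_coset N u (degree_part N i p)" if "N > 0"
    by (simp add: defs a_r_coset_kummer)
       (rule Union_kummer_coset, use that in \<open>auto simp: degree_part_kummer_poly_mult elim!: dvdE simp flip: degree_part_diff\<close>)
qed

lemma cring_kummer: "cring (kummer_torsor N u)"
proof -
  have inv: "\<exists>y. kummer_coset N u (p + y) = kummer_coset N u 0" for p
    by (rule exI[of _ "- p"]) simp
  show ?thesis
    by (intro cringI abelian_groupI comm_monoidI)
       (auto simp: carrier_kummer mult_kummer add_kummer one_kummer zero_kummer algebra_simps inv)
qed

lemma algebra_kummer: "algebra rng (kummer_torsor N u)"
  by (intro algebraI cring_from_type_algebra cring_kummer)
     (auto simp: carrier_kummer mult_kummer add_kummer one_kummer zero_kummer smult_kummer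
       smult_add_left smult_add_right)

lemma finsum_kummer:
  assumes "finite S" and F: "\<And>i. i \<in> S \<Longrightarrow> F i = kummer_coset N u (f i)"
  shows "finsum (kummer_torsor N u) F S = kummer_coset N u (sum f S)"
proof -
  interpret cring "kummer_torsor N u" by (rule cring_kummer)
  from assms show ?thesis
  proof (induction S rule: finite_induct)
    case (insert x S)
    then have "finsum (kummer_torsor N u) F (insert x S) = F x \<oplus>\<^bsub>kummer_torsor N u\<^esub> finsum (kummer_torsor N u) F S"
      by (intro finsum_insert) (auto simp: carrier_kummer)
    then show ?case using insert by (simp add: add_kummer)
  qed (simp add: zero_kummer)
qed


lemma mu_coaction_kummer:
  assumes "N > 0"
  shows "mu_coaction N (kummer_torsor N u)"
proof -
  note simps = carrier_kummer coact_kummer[OF assms] add_kummer smult_kummer one_kummer zero_kummer mult_kummer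
  have mult: "(\<Oplus>\<^bsub>kummer_torsor N u\<^esub>j\<in>{..<N}. kummer_coset N u (degree_part N j p) \<otimes>\<^bsub>kummer_torsor N u\<^esub>
        kummer_coset N u (degree_part N ((i + N - j) mod N) q)) = kummer_coset N u (degree_part N i (p * q))"
    if "i < N" for i p q
    by (subst finsum_kummer) (auto simp: mult_kummer degree_part_mult[OF that])
  have counit: "(\<Oplus>\<^bsub>kummer_torsor N u\<^esub>i\<in>{..<N}. kummer_coset N u (degree_part N i p)) = kummer_coset N u p" for p
    by (subst finsum_kummer) (auto simp: sum_degree_part[OF assms])
  show ?thesis
    unfolding mu_coaction_def
    by (auto simp: algebra_kummer simps mult counit degree_part_add degree_part_smult degree_part_1
        degree_part_degree_part) (auto simp flip: mult_kummer simp: mult)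
qed

text \<open>Coefficient families on a basis, indexed by its elements, may be reindexed by the positions of the
  elements.\<close>

lemma ex1_PiE_image:
  assumes b: "inj_on b I"
    and ex1: "\<exists>!d. d \<in> I \<rightarrow>\<^sub>E V \<and> Q d"
    and PQ: "\<And>c. c \<in> b ` I \<rightarrow>\<^sub>E V \<Longrightarrow> P c \<longleftrightarrow> Q (restrict (c \<circ> b) I)"
  shows "\<exists>!c. c \<in> b ` I \<rightarrow>\<^sub>E V \<and> P c"
proof -
  obtain d where d: "d \<in> I \<rightarrow>\<^sub>E V" "Q d" and uniq: "\<And>e. e \<in> I \<rightarrow>\<^sub>E V \<Longrightarrow> Q e \<Longrightarrow> e = d"
    using ex1 by blast
  define c where "c = restrict (d \<circ> the_inv_into I b) (b ` I)"
  have c: "c \<in> b ` I \<rightarrow>\<^sub>E V" using d(1) by (auto simp: c_def the_inv_into_f_f[OF b])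
  have "restrict (c \<circ> b) I = d"
    using d(1) by (intro PiE_ext[of _ I "\<lambda>_. V"]) (auto simp: c_def the_inv_into_f_f[OF b])
  then have Pc: "P c" using PQ[OF c] d(2) by simp
  have unique: "c' = c" if "c' \<in> b ` I \<rightarrow>\<^sub>E V" "P c'" for c'
  proof -
    have "restrict (c' \<circ> b) I = d" using PQ that by (intro uniq) auto
    then have "\<And>i. i \<in> I \<Longrightarrow> c' (b i) = d i" by (metis comp_apply restrict_apply')
    then show ?thesis
      using that(1) c by (intro PiE_ext[of _ "b ` I" "\<lambda>_. V"]) (auto simp: c_def the_inv_into_f_f[OF b])
  qed
  show ?thesis by (rule ex1I[of _ c]) (use c Pc in simp, blast intro: unique)
qed

text \<open>Replacing \<open>y\<^sup>N\<close> by \<open>u\<close> repeatedly. Applied to each term, this reduces every polynomial to degree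
  below \<open>N\<close>.\<close>

lemma kummer_power_reduce:
  "kummer_poly N u dvd Polynomial.monom r (q * N + j) - Polynomial.monom (r * u ^ q) j"
proof (induction q arbitrary: r)
  case (Suc q)
  have "Polynomial.monom r (Suc q * N + j) - Polynomial.monom (r * u ^ Suc q) j =
     kummer_poly N u * Polynomial.monom r (q * N + j)
     + (Polynomial.monom (r * u) (q * N + j) - Polynomial.monom (r * u * u ^ q) j)"
    by (simp add: kummer_poly_def left_diff_distrib mult_monom smult_monom ac_simps)
  then show ?case using Suc[of "r * u"] by (metis dvd_add dvd_triv_left)
qed simp

text \<open>A multiple of the monic polynomial \<open>y\<^sup>N - u\<close> of degree below \<open>N\<close> vanishes, whence linear
  independence of the powers of \<open>y\<close>.\<close>

lemma kummer_poly_degree: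
  fixes u :: "'r::idom"
  assumes "N > 0" and "kummer_poly N u dvd p" and "\<And>m. m \<ge> N \<Longrightarrow> Polynomial.coeff p m = 0"
  shows "p = 0"
proof (rule ccontr)
  assume p: "p \<noteq> 0"
  have "Polynomial.coeff (kummer_poly N u) N = 1"
    using assms(1) by (simp add: kummer_poly_def coeff_pCons split: nat.split)
  then have "N \<le> Polynomial.degree (kummer_poly N u)" by (intro le_degree) simp
  also have "\<dots> \<le> Polynomial.degree p" using dvd_imp_degree_le[OF assms(2) p] .
  finally show False using assms(3) p leading_coeff_neq_0 by blast
qed

lemma kummer_coset_remainder:
  assumes N: "N > 0"
  obtains d where "kummer_coset N u p = kummer_coset N u (\<Sum>j<N. Polynomial.monom (d j) j)"
proof -
  let ?f = "\<lambda>m. Polynomial.monom (Polynomial.coeff p m * u ^ (m div N)) (m mod N)"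
  have "p - (\<Sum>m\<le>Polynomial.degree p. ?f m) =
      (\<Sum>m\<le>Polynomial.degree p. Polynomial.monom (Polynomial.coeff p m) m - ?f m)"
    by (simp add: sum_subtractf poly_as_sum_of_monoms)
  moreover have "kummer_poly N u dvd Polynomial.monom (Polynomial.coeff p m) m - ?f m" for m
    using kummer_power_reduce[of N u "Polynomial.coeff p m" "m div N" "m mod N"] by simp
  ultimately have "kummer_poly N u dvd p - (\<Sum>m\<le>Polynomial.degree p. ?f m)"
    by (simp add: dvd_sum)
  also have "(\<Sum>m\<le>Polynomial.degree p. ?f m) =
      (\<Sum>j<N. \<Sum>m | m \<in> {..Polynomial.degree p} \<and> m mod N = j. ?f m)"
    using N by (intro sum.group[symmetric]) auto
  also have "\<dots> = (\<Sum>j<N. \<Sum>m | m \<le> Polynomial.degree p \<and> m mod N = j.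
      Polynomial.monom (Polynomial.coeff p m * u ^ (m div N)) j)"
    by (intro sum.cong) auto
  also have "\<dots> = (\<Sum>j<N. Polynomial.monom
    (\<Sum>m | m \<le> Polynomial.degree p \<and> m mod N = j. Polynomial.coeff p m * u ^ (m div N)) j)"
    by (simp add: monom_hom.hom_sum)
  finally show thesis
    by (intro that[of "\<lambda>j. \<Sum>m | m \<le> Polynomial.degree p \<and> m mod N = j. Polynomial.coeff p m * u ^ (m div N)"])
       (simp add: kummer_coset_eq_iff)
qed

text \<open>The powers of \<open>y\<close> below \<open>N\<close> are a basis of \<open>R[y]/(y\<^sup>N - u)\<close>. The \<open>z\<^sup>i\<close>-component of the
  coaction retains the single basis element \<open>y\<^sup>i\<close>, and \<open>y\<close> is invertible because \<open>u\<close> is; so a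
  prescribed \<open>z\<^sup>i\<close>-component \<open>g i\<close> is reached by the coefficient \<open>g i y\<^sup>-\<^sup>i\<close>, and only by it.\<close>

lemma mu_torsor_kummer:
  fixes u :: "'r::idom"
  assumes N: "N > 0" and u: "u dvd 1"
  shows "mu_torsor N (kummer_torsor N u)"
proof -
  let ?K = "kummer_torsor N u"
  define b where "b j = kummer_coset N u (Polynomial.monom 1 j)" for j
  interpret K: cring ?K by (rule cring_kummer)
  note simps = carrier_kummer coact_kummer[OF N] add_kummer smult_kummer one_kummer zero_kummer mult_kummer
  have sum_eq: "d = d'"
    if eq: "kummer_coset N u (\<Sum>j<N. Polynomial.monom (d j) j) = kummer_coset N u (\<Sum>j<N. Polynomial.monom (d' j) j)"
      and d: "d \<in> {..<N} \<rightarrow>\<^sub>E UNIV" "d' \<in> {..<N} \<rightarrow>\<^sub>E UNIV" for d d' :: "nat \<Rightarrow> 'r"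
  proof -
    let ?p = "\<Sum>j<N. Polynomial.monom (d j - d' j) j"
    have coeff: "Polynomial.coeff ?p m = (if m < N then d m - d' m else 0)" for m
      by (simp add: coeff_sum)
    have "(\<Sum>j<N. Polynomial.monom (d j) j) - (\<Sum>j<N. Polynomial.monom (d' j) j) = ?p"
      by (simp add: sum_subtractf diff_monom[symmetric])
    then have "kummer_poly N u dvd ?p" using eq by (simp add: kummer_coset_eq_iff)
    then have "?p = 0" by (rule kummer_poly_degree[OF N]) (simp add: coeff)
    then have "d m = d' m" if "m < N" for m using coeff[of m] that by simp
    then show ?thesis by (intro PiE_ext[OF d]) auto
  qed
  have inj: "inj_on b {..<N}"
  proof
    fix i j assume ij: "i \<in> {..<N}" "j \<in> {..<N}" "b i = b j"
    let ?p = "Polynomial.monom 1 i - Polynomial.monom 1 j :: 'r poly"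
    have "kummer_poly N u dvd ?p" using ij(3) by (simp add: b_def kummer_coset_eq_iff)
    then have "?p = 0" by (rule kummer_poly_degree[OF N]) (use ij in auto)
    then have "Polynomial.coeff ?p i = 0" by simp
    then show "i = j" by (auto split: if_splits)
  qed
  have b_carrier: "b j \<in> carrier ?K" for j by (simp add: b_def simps)
  have basis: "module_basis ?K (b ` {..<N})"
    unfolding module_basis_def
  proof (intro conjI ballI)
    fix x assume "x \<in> carrier ?K"
    then obtain p where p: "x = kummer_coset N u p" by (auto simp: simps)
    obtain d0 where "kummer_coset N u p = kummer_coset N u (\<Sum>j<N. Polynomial.monom (d0 j) j)"
      by (rule kummer_coset_remainder[OF N])
    with p have d0: "x = kummer_coset N u (\<Sum>j<N. Polynomial.monom (d0 j) j)" by simp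
    show "\<exists>!c. c \<in> b ` {..<N} \<rightarrow>\<^sub>E UNIV \<and> x = (\<Oplus>\<^bsub>?K\<^esub>e\<in>b ` {..<N}. c e \<odot>\<^bsub>?K\<^esub> e)"
    proof (rule ex1_PiE_image[OF inj, where Q = "\<lambda>d. x = kummer_coset N u (\<Sum>j<N. Polynomial.monom (d j) j)"])
      show "\<exists>!d. d \<in> {..<N} \<rightarrow>\<^sub>E UNIV \<and> x = kummer_coset N u (\<Sum>j<N. Polynomial.monom (d j) j)"
      proof (rule ex1I[of _ "restrict d0 {..<N}"])
        show *: "restrict d0 {..<N} \<in> {..<N} \<rightarrow>\<^sub>E UNIV \<and>
            x = kummer_coset N u (\<Sum>j<N. Polynomial.monom (restrict d0 {..<N} j) j)"
          by (auto simp: d0 intro!: arg_cong[where f = "kummer_coset N u"] sum.cong)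
        fix d assume "d \<in> {..<N} \<rightarrow>\<^sub>E UNIV \<and> x = kummer_coset N u (\<Sum>j<N. Polynomial.monom (d j) j)"
        then show "d = restrict d0 {..<N}" using * by (intro sum_eq) auto
      qed
      fix c :: "'r poly set \<Rightarrow> 'r"
      have "(\<Oplus>\<^bsub>?K\<^esub>e\<in>b ` {..<N}. c e \<odot>\<^bsub>?K\<^esub> e) = (\<Oplus>\<^bsub>?K\<^esub>j\<in>{..<N}. c (b j) \<odot>\<^bsub>?K\<^esub> b j)"
        by (rule K.finsum_reindex[OF _ inj]) (auto simp: b_def simps)
      also have "\<dots> = kummer_coset N u (\<Sum>j<N. Polynomial.monom (restrict (c \<circ> b) {..<N} j) j)"
        by (rule finsum_kummer) (auto simp: b_def simps smult_monom)
      finally show "x = (\<Oplus>\<^bsub>?K\<^esub>e\<in>b ` {..<N}. c e \<odot>\<^bsub>?K\<^esub> e) \<longleftrightarrow>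
          x = kummer_coset N u (\<Sum>j<N. Polynomial.monom (restrict (c \<circ> b) {..<N} j) j)" by simp
    qed
  qed (use b_carrier in auto)
  obtain w where w: "u * w = 1" using u by (metis dvdE)
  define b' where "b' i = kummer_coset N u (Polynomial.monom w (N - i))" for i
  have b': "b i \<otimes>\<^bsub>?K\<^esub> b' i = \<one>\<^bsub>?K\<^esub>" "b' i \<in> carrier ?K" if "i < N" for i
  proof -
    have "Polynomial.monom w N - 1 = kummer_poly N u * [:w:]"
      using w by (simp add: kummer_poly_def smult_diff_right smult_monom one_pCons mult.commute)
    then show "b i \<otimes>\<^bsub>?K\<^esub> b' i = \<one>\<^bsub>?K\<^esub>"
      using that by (simp add: b_def b'_def simps mult_monom kummer_coset_eq_iff dvd_smult)
  qed (simp add: b'_def simps)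
  have "\<exists>!c. c \<in> b ` {..<N} \<rightarrow>\<^sub>E carrier ?K \<and>
      (\<forall>i<N. g i = (\<Oplus>\<^bsub>?K\<^esub>e\<in>b ` {..<N}. c e \<otimes>\<^bsub>?K\<^esub> coact ?K i e))"
    if g: "g \<in> {..<N} \<rightarrow>\<^sub>E carrier ?K" for g
  proof (rule ex1_PiE_image[OF inj, where Q = "\<lambda>d. \<forall>i<N. d i \<otimes>\<^bsub>?K\<^esub> b i = g i"])
    have g': "g i \<in> carrier ?K" if "i < N" for i using g that by auto
    have recover: "g i \<otimes>\<^bsub>?K\<^esub> b' i \<otimes>\<^bsub>?K\<^esub> b i = g i" if "i < N" for i
      using b_carrier[of i] b'[OF that] g'[OF that] by (simp add: K.m_assoc K.m_comm[of "b' i"])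
    have forth: "x = g i \<otimes>\<^bsub>?K\<^esub> b' i" if "i < N" "x \<in> carrier ?K" "x \<otimes>\<^bsub>?K\<^esub> b i = g i" for i x
      using b_carrier[of i] b'[OF that(1)] that(2) by (simp add: K.m_assoc flip: that(3))
    show "\<exists>!d. d \<in> {..<N} \<rightarrow>\<^sub>E carrier ?K \<and> (\<forall>i<N. d i \<otimes>\<^bsub>?K\<^esub> b i = g i)"
    proof (rule ex1I[of _ "restrict (\<lambda>i. g i \<otimes>\<^bsub>?K\<^esub> b' i) {..<N}"])
      have "g i \<otimes>\<^bsub>?K\<^esub> b' i \<in> carrier ?K" if "i < N" for i using g' b'(2) that by simp
      then show *: "restrict (\<lambda>i. g i \<otimes>\<^bsub>?K\<^esub> b' i) {..<N} \<in> {..<N} \<rightarrow>\<^sub>E carrier ?K \<and>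
          (\<forall>i<N. restrict (\<lambda>i. g i \<otimes>\<^bsub>?K\<^esub> b' i) {..<N} i \<otimes>\<^bsub>?K\<^esub> b i = g i)"
        by (simp add: recover)
      fix d assume d: "d \<in> {..<N} \<rightarrow>\<^sub>E carrier ?K \<and> (\<forall>i<N. d i \<otimes>\<^bsub>?K\<^esub> b i = g i)"
      then have "d i = g i \<otimes>\<^bsub>?K\<^esub> b' i" if "i < N" for i
        using that by (intro forth) auto
      then show "d = restrict (\<lambda>i. g i \<otimes>\<^bsub>?K\<^esub> b' i) {..<N}"
        using d * by (intro PiE_ext[of d "{..<N}" "\<lambda>_. carrier ?K"]) auto
    qed
  next
    fix c assume c: "c \<in> b ` {..<N} \<rightarrow>\<^sub>E carrier ?K"
    then have "\<forall>j<N. \<exists>q. c (b j) = kummer_coset N u q" by (auto simp: simps PiE_def Pi_def)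
    then obtain q where q: "\<And>j. j < N \<Longrightarrow> c (b j) = kummer_coset N u (q j)" by metis
    have "(\<Oplus>\<^bsub>?K\<^esub>e\<in>b ` {..<N}. c e \<otimes>\<^bsub>?K\<^esub> coact ?K i e) = c (b i) \<otimes>\<^bsub>?K\<^esub> b i" if i: "i < N" for i
    proof -
      have "(\<Oplus>\<^bsub>?K\<^esub>e\<in>b ` {..<N}. c e \<otimes>\<^bsub>?K\<^esub> coact ?K i e) =
          (\<Oplus>\<^bsub>?K\<^esub>j\<in>{..<N}. c (b j) \<otimes>\<^bsub>?K\<^esub> coact ?K i (b j))"
        by (rule K.finsum_reindex[OF _ inj]) (auto simp: q, auto simp: b_def simps)
      also have "\<dots> = kummer_coset N u (\<Sum>j<N. if i = j then q j * Polynomial.monom 1 j else 0)"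
        by (rule finsum_kummer) (auto simp: q, auto simp: b_def simps degree_part_monom)
      also have "\<dots> = c (b i) \<otimes>\<^bsub>?K\<^esub> b i" using i by (simp add: q) (simp add: b_def simps)
      finally show ?thesis .
    qed
    then show "(\<forall>i<N. g i = (\<Oplus>\<^bsub>?K\<^esub>e\<in>b ` {..<N}. c e \<otimes>\<^bsub>?K\<^esub> coact ?K i e)) \<longleftrightarrow>
        (\<forall>i<N. restrict (c \<circ> b) {..<N} i \<otimes>\<^bsub>?K\<^esub> b i = g i)" by auto
  qed
  then show ?thesis
    unfolding mu_torsor_def using mu_coaction_kummer[OF N] basis N
    by (intro conjI exI[of _ "b ` {..<N}"]) (simp_all add: lessThan_empty_iff)
qed

lemma mu_isomorphic_trans:
  assumes "mu_isomorphic N B C" and "mu_isomorphic N C D"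
  shows "mu_isomorphic N B D"
proof -
  obtain g h where g: "g \<in> ring_iso B C" "\<And>x r. x \<in> carrier B \<Longrightarrow> g (r \<odot>\<^bsub>B\<^esub> x) = r \<odot>\<^bsub>C\<^esub> g x"
      "\<And>x i. x \<in> carrier B \<Longrightarrow> i < N \<Longrightarrow> g (coact B i x) = coact C i (g x)"
    and h: "h \<in> ring_iso C D" "\<And>x r. x \<in> carrier C \<Longrightarrow> h (r \<odot>\<^bsub>C\<^esub> x) = r \<odot>\<^bsub>D\<^esub> h x"
      "\<And>x i. x \<in> carrier C \<Longrightarrow> i < N \<Longrightarrow> h (coact C i x) = coact D i (h x)"
    using assms unfolding mu_isomorphic_def by blast
  have "g x \<in> carrier C" if "x \<in> carrier B" for x using ring_iso_memE(1)[OF g(1) that] .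
  then show ?thesis
    unfolding mu_isomorphic_def
    using ring_iso_set_trans[OF g(1) h(1)] g(2,3) h(2,3) by (intro bexI[of _ "h \<circ> g"]) auto
qed

text \<open>With \<open>v w = 1\<close>, the substitution \<open>y \<mapsto> w y\<close> takes \<open>y\<^sup>N - u\<close> to \<open>w\<^sup>N (y\<^sup>N - u v\<^sup>N)\<close>, and
  it preserves degrees, on which alone the coaction depends.\<close>

lemma mu_isomorphic_kummer:
  fixes u v :: "'r::idom"
  assumes N: "N > 0" and v: "v dvd 1"
  shows "mu_isomorphic N (kummer_torsor N u) (kummer_torsor N (u * v ^ N))"
proof -
  obtain w where w: "v * w = 1" using v by (metis dvdE)
  let ?K = "kummer_torsor N u" and ?K' = "kummer_torsor N (u * v ^ N)"
  define S where "S a p = pcompose p [:0, a:]" for a :: 'r and p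
  have coeff_S: "Polynomial.coeff (S a p) m = a ^ m * Polynomial.coeff p m" for a p m
    by (simp add: S_def coeff_pcompose_linear)
  have SS: "S v (S w p) = p" "S w (S v p) = p" for p
    using w by (auto intro!: poly_eqI simp: coeff_S simp flip: mult.assoc power_mult_distrib)
      (auto simp: mult.commute)
  have S_hom: "S a (p + q) = S a p + S a q" "S a (p - q) = S a p - S a q" "S a (p * q) = S a p * S a q"
    "S a 1 = 1" "S a (Polynomial.smult r p) = Polynomial.smult r (S a p)"
    "S a (degree_part N i p) = degree_part N i (S a p)" for a r p q i
    by (simp_all add: S_def pcompose_add pcompose_diff pcompose_mult pcompose_smult one_pCons pcompose_pCons)
       (rule poly_eqI, simp add: coeff_degree_part coeff_pcompose_linear)
  have vw: "v ^ N * w ^ N = 1" using w by (simp flip: power_mult_distrib)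
  have "S w (kummer_poly N u) = Polynomial.smult (w ^ N) (kummer_poly N (u * v ^ N))"
    using vw N by (intro poly_eqI) (auto simp: coeff_S kummer_poly_def coeff_pCons mult_ac split: nat.split)
  then have dvd: "kummer_poly N (u * v ^ N) dvd S w p" if "kummer_poly N u dvd p" for p
    using that by (auto simp: S_hom intro!: dvd_smult elim!: dvdE)
  have "S v (kummer_poly N (u * v ^ N)) = Polynomial.smult (v ^ N) (kummer_poly N u)"
    using N by (intro poly_eqI) (auto simp: coeff_S kummer_poly_def coeff_pCons mult_ac split: nat.split)
  then have dvd': "kummer_poly N u dvd S v p" if "kummer_poly N (u * v ^ N) dvd p" for p
    using that by (auto simp: S_hom intro!: dvd_smult elim!: dvdE)
  define h where "h C = (\<Union>q\<in>C. kummer_coset N (u * v ^ N) (S w q))" for C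
  have h: "h (kummer_coset N u p) = kummer_coset N (u * v ^ N) (S w p)" for p
    unfolding h_def by (rule Union_kummer_coset) (simp add: dvd flip: S_hom)
  note simps = carrier_kummer coact_kummer[OF N] add_kummer smult_kummer one_kummer zero_kummer mult_kummer
  have "inj_on h (carrier ?K)"
  proof
    fix x y assume xy: "x \<in> carrier ?K" "y \<in> carrier ?K" "h x = h y"
    obtain p q where pq: "x = kummer_coset N u p" "y = kummer_coset N u q"
      using xy by (auto simp: simps)
    then have "kummer_poly N (u * v ^ N) dvd S w (p - q)"
      using xy(3) by (simp add: h kummer_coset_eq_iff S_hom)
    then have "kummer_poly N u dvd S v (S w (p - q))" by (intro dvd')
    then show "x = y" by (simp add: pq SS kummer_coset_eq_iff)
  qed
  moreover have "h ` carrier ?K = carrier ?K'"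
  proof -
    have "kummer_coset N (u * v ^ N) p \<in> h ` carrier ?K" for p
      by (rule image_eqI[of _ _ "kummer_coset N u (S v p)"]) (simp_all add: h SS simps)
    then show ?thesis by (auto simp: simps h)
  qed
  ultimately have "h \<in> ring_iso ?K ?K'"
    by (intro ring_iso_memI) (auto simp: simps h S_hom bij_betw_def)
  then show ?thesis
    unfolding mu_isomorphic_def by (intro bexI[of _ h]) (auto simp: simps h S_hom)
qed

text \<open>The inverse of \<open>v\<close> gives the isomorphism in the other direction, so transitivity alone yields the
  equality of classes.\<close>

lemma kummer_class_mult_power:
  fixes u v :: "'r::idom"
  assumes N: "N > 0" and u: "u dvd 1" and v: "v dvd 1"
  shows "kummer_class N (u * v ^ N) = kummer_class N u"
proof -
  obtain w where w: "v * w = 1" using v by (metis dvdE)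
  then have "w dvd 1" by (metis dvd_triv_right)
  then have "mu_isomorphic N (kummer_torsor N (u * v ^ N)) (kummer_torsor N (u * v ^ N * w ^ N))"
    by (rule mu_isomorphic_kummer[OF N])
  moreover have "u * v ^ N * w ^ N = u" using w by (simp add: mult.assoc flip: power_mult_distrib)
  ultimately have "mu_isomorphic N (kummer_torsor N (u * v ^ N)) (kummer_torsor N u)" by simp
  moreover have "u * v ^ N dvd u * v ^ N * w ^ N" by simp
  then have "u * v ^ N dvd 1" using \<open>u * v ^ N * w ^ N = u\<close> u dvd_trans by metis
  ultimately show ?thesis
    unfolding kummer_class_def torsor_rel_def
    using mu_torsor_kummer[OF N] u mu_isomorphic_kummer[OF N v, of u]
    by (auto intro: mu_isomorphic_trans)
qed

lemma kummer_class_in_H1: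
  "N > 0 \<Longrightarrow> u dvd 1 \<Longrightarrow> kummer_class N u \<in> H1_mu N" for u :: "'r::idom"
  unfolding H1_mu_def kummer_class_def by (rule quotientI) (simp add: mu_torsor_kummer)

section \<open>Unit values of the index form\<close>

lemma carrier_unit_group: "carrier (unit_group :: 'r::comm_ring_1 monoid) = {u. u dvd 1}"
  by (simp add: unit_group_def units_of_carrier Units_rng)

lemma unit_powers_eq: "unit_powers N = {v ^ N | v :: 'r::comm_ring_1. v dvd 1}"
  by (auto simp: unit_powers_def carrier_unit_group)

lemma unit_class_eq: "unit_class N u = {u * v ^ N | v :: 'r::comm_ring_1. v dvd 1}"
  by (auto simp: unit_class_def r_coset_def unit_powers_eq unit_group_def units_of_mult mult.commute)

lemma unit_class_mult_power:
  fixes u v :: "'r::comm_ring_1"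
  assumes "v dvd 1"
  shows "unit_class N (u * v ^ N) = unit_class N u"
proof -
  obtain w where w: "v * w = 1" using assms by (metis dvdE)
  have "\<exists>y. u * v ^ N * x ^ N = u * y ^ N \<and> y dvd 1" if "x dvd 1" for x
    using mult_dvd_mono[OF assms that]
    by (intro exI[of _ "v * x"]) (simp add: power_mult_distrib mult.assoc)
  moreover have "\<exists>y. u * x ^ N = u * v ^ N * y ^ N \<and> y dvd 1" if "x dvd 1" for x
  proof (intro exI conjI)
    have "u * v ^ N * (w * x) ^ N = u * (v * w) ^ N * x ^ N"
      by (simp add: power_mult_distrib mult_ac)
    then show "u * x ^ N = u * v ^ N * (w * x) ^ N" by (simp add: w)
    have "w dvd 1" using w by (metis dvd_triv_right)
    then show "w * x dvd 1" using mult_dvd_mono[OF _ that, of w 1] by simp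
  qed
  ultimately show ?thesis unfolding unit_class_eq by auto
qed

lemma is_unit_of_power: "x ^ N dvd 1 \<Longrightarrow> N > 0 \<Longrightarrow> x dvd 1" for x :: "'a::comm_semiring_1"
  by (metis dvd_power dvd_trans)

lemma kummer_map_unit_class:
  fixes u :: "'r::idom"
  assumes "N > 0" and "u dvd 1"
  shows "kummer_map N (unit_class N u) = kummer_class N u"
proof -
  have "1 \<in> {v :: 'r. v dvd 1}" by simp
  then show ?thesis
    unfolding kummer_map_def unit_class_eq
    using kummer_class_mult_power[OF assms] by auto (metis dvd_refl)
qed

text \<open>The volume of the powers of a generator is a unit congruent to some \<open>a\<^sup>N\<close> modulo \<open>P\<close>. Its
  quotient by \<open>a\<^sup>N\<close> is congruent to \<open>1\<close>, and so is itself an \<open>N\<close>-th power.\<close>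

lemma (in totally_ramified) volume_powers_is_power:
  fixes \<phi> :: "'r \<Rightarrow> 'k::field"
  assumes N: "N = n * (n - 1) div 2" "N > 0" and N_unit: "of_nat N dvd (1 :: 'r)"
    and complete: "adically_complete P"
    and \<phi>: "comm_ring_hom \<phi>" and ker: "\<And>r. \<phi> r = 0 \<longleftrightarrow> r \<in> P"
    and \<beta>: "adjoin scale \<beta> = UNIV"
  obtains v where "v dvd 1" and "volume (powers n \<beta>) = v ^ N"
proof -
  interpret \<phi>: comm_ring_hom \<phi> by (rule \<phi>)
  let ?d = "volume (powers n \<beta>)"
  obtain a where a: "\<phi> ?d = \<phi> a ^ N"
    using volume_powers_residue[OF \<phi> ker] N(1) by metis
  have d: "?d dvd 1" using volume_powers_unit[OF \<beta>] by simp
  then have "\<phi> ?d \<noteq> 0" by (simp add: ker dvr_nonunit_iff[OF P])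
  then have "\<phi> a \<noteq> 0" using a N(2) by auto
  then have "a dvd 1" by (simp add: ker dvr_nonunit_iff[OF P])
  then obtain b where b: "a * b = 1" by (metis dvdE)
  have "\<phi> (?d * b ^ N - 1) = \<phi> ((a * b) ^ N) - 1"
    by (simp add: \<phi>.hom_minus \<phi>.hom_mult \<phi>.hom_power a power_mult_distrib)
  then have "?d * b ^ N - 1 \<in> P" by (simp add: b flip: ker)
  then obtain y where "y ^ N = ?d * b ^ N"
    using power_root_near_one[OF P complete N_unit] by blast
  then have "(a * y) ^ N = ?d * (a * b) ^ N" by (simp add: power_mult_distrib mult_ac)
  then have eq: "?d = (a * y) ^ N" by (simp add: b)
  then have "a * y dvd 1" using d N(2) is_unit_of_power by metis
  then show thesis using eq by (rule that)
qed

theorem theorem3p7: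
  fixes n N p :: nat
    and P :: "'r::idom set"
    and M :: "'a::idom set"
    and scale :: "'r \<Rightarrow> 'a \<Rightarrow> 'a"
    and \<pi> :: 'a
    and \<omega> :: "('a list \<Rightarrow>\<^sub>0 'r) set"
  defines "f \<equiv> index_form scale n \<omega>"
    and "gens \<equiv> {\<beta>. adjoin scale \<beta> = UNIV}"
  assumes "n \<ge> 2" and "N = n * (n - 1) div 2"
    and "dvr_with_maximal P" and "adically_complete P"
    and "(rng :: 'r ring) Quot P \<simeq> (rng :: 'k::field ring)" and "p = CHAR('k)"
    and "comm_algebra scale" and "free_of_rank scale n"
    and "dvr_with_maximal M"
    and "(rng :: 'a ring) Quot M \<simeq> (rng :: 'k ring)"
    and "M = PIdl\<^bsub>rng\<^esub> \<pi>" and "adjoin scale \<pi> = UNIV"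
    and "orientation scale n \<omega>"
    and "\<not> p dvd N"
  shows "f ` gens \<subseteq> carrier unit_group \<and>
         f ` gens = (\<lambda>v. f \<pi> * v) ` unit_powers N \<and>
         (\<forall>\<beta>\<in>gens. unit_class N (f \<beta>) = unit_class N (f \<pi>)) \<and>
         kummer_class N (f \<pi>) \<in> H1_mu N \<and>
         (\<forall>\<beta>\<in>gens. kummer_map N (unit_class N (f \<beta>)) = kummer_class N (f \<pi>))"
proof -
  have N: "N > 0"
  proof -
    have "2 * 1 \<le> n * (n - 1)" using \<open>n \<ge> 2\<close> by (intro mult_le_mono) auto
    then show ?thesis using \<open>N = n * (n - 1) div 2\<close> by simp
  qed
  obtain \<phi> :: "'r \<Rightarrow> 'k" where \<phi>: "comm_ring_hom \<phi>" and ker: "\<And>r. \<phi> r = 0 \<longleftrightarrow> r \<in> P"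
    using residue_hom[OF dvr_ideal[OF \<open>dvr_with_maximal P\<close>] \<open>(rng :: 'r ring) Quot P \<simeq> rng\<close>] by blast
  interpret \<phi>: comm_ring_hom \<phi> by (rule \<phi>)
  have "\<phi> (of_nat N) \<noteq> 0"
    using \<open>\<not> p dvd N\<close> \<open>p = CHAR('k)\<close> by (simp add: \<phi>.hom_of_nat of_nat_eq_0_iff_char_dvd)
  then have N_unit: "of_nat N dvd (1 :: 'r)"
    by (simp add: ker dvr_nonunit_iff[OF \<open>dvr_with_maximal P\<close>])
  obtain E where E: "finite E" "card E = n" "\<not> Modules.module.dependent scale E" "Modules.module.span scale E = UNIV"
    using \<open>free_of_rank scale n\<close> by (auto simp: free_of_rank_def)
  obtain es where es: "set es = E" "distinct es" using finite_distinct_list[OF E(1)] by blast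
  interpret basis: free_algebra scale es
    by unfold_locales (use es E \<open>comm_algebra scale\<close> in auto)
  have len: "length es = n" using es E(2) distinct_card by metis
  interpret totally_ramified scale n \<pi> P M
  proof (rule totally_ramified.intro)
    show "free_algebra scale (powers n \<pi>)"
      using basis.free_algebra_powers[OF \<open>adjoin scale \<pi> = UNIV\<close>] by (simp add: len)
    show "totally_ramified_axioms scale \<pi> P M"
      by unfold_locales (use assms in \<open>auto simp: cgenideal_rng\<close>)
  qed
  obtain d where d: "d dvd 1" and fd: "\<And>\<beta>. f \<beta> * d = volume (powers n \<beta>)"
    using orientation_index_form[of \<omega>] \<open>orientation scale n \<omega>\<close> unfolding f_def by (metis powers_simps(1))
  have f\<pi>: "f \<pi> * d = 1" using fd[of \<pi>] volume_basis by simp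
  have f: "f \<beta> = f \<pi> * volume (powers n \<beta>)" for \<beta>
  proof -
    have "f \<pi> * volume (powers n \<beta>) = f \<beta> * (f \<pi> * d)" by (simp add: mult_ac flip: fd)
    then show ?thesis by (simp add: f\<pi>)
  qed
  have unit: "f \<pi> dvd 1" using f\<pi> by (metis dvd_triv_left)
  have forth: "\<exists>v. v dvd 1 \<and> f \<beta> = f \<pi> * v ^ N" if "\<beta> \<in> gens" for \<beta>
  proof -
    have "adjoin scale \<beta> = UNIV" using that by (simp add: gens_def)
    with \<open>N = n * (n - 1) div 2\<close> N N_unit \<open>adically_complete P\<close> \<phi> ker
    obtain v where "v dvd 1" "volume (powers n \<beta>) = v ^ N"
      by (rule volume_powers_is_power)
    then show ?thesis using f[of \<beta>] by auto
  qed
  have conv: "\<exists>\<beta>\<in>gens. f \<beta> = f \<pi> * v ^ N" if "v dvd 1" for v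
  proof (rule bexI[of _ "scale v \<pi>"])
    show "f (scale v \<pi>) = f \<pi> * v ^ N"
      using volume_basis by (simp add: f[of "scale v \<pi>"] volume_powers_scale \<open>N = n * (n - 1) div 2\<close>)
    show "scale v \<pi> \<in> gens" using adjoin_scale_generator[OF that] by (simp add: gens_def)
  qed
  have units: "f \<beta> dvd 1" if "\<beta> \<in> gens" for \<beta>
  proof -
    have "f \<beta> dvd volume (powers n \<beta>)" using fd[of \<beta>] by (metis dvd_triv_left)
    moreover have "volume (powers n \<beta>) dvd 1"
      using volume_powers_unit[of \<beta>] that by (simp add: gens_def)
    ultimately show ?thesis by (rule dvd_trans)
  qed
  have classes: "unit_class N (f \<beta>) = unit_class N (f \<pi>)" if "\<beta> \<in> gens" for \<beta>
    using forth[OF that] unit_class_mult_power by metis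
  show ?thesis
  proof (intro conjI ballI)
    show "f ` gens \<subseteq> carrier unit_group" using units by (auto simp: carrier_unit_group)
    show "f ` gens = (\<lambda>v. f \<pi> * v) ` unit_powers N"
    proof (intro equalityI subsetI)
      fix x assume "x \<in> f ` gens"
      then obtain \<beta> where \<beta>: "\<beta> \<in> gens" "x = f \<beta>" by blast
      then show "x \<in> (\<lambda>v. f \<pi> * v) ` unit_powers N"
        using forth[OF \<beta>(1)] by (auto simp: unit_powers_eq)
    next
      fix x assume "x \<in> (\<lambda>v. f \<pi> * v) ` unit_powers N"
      then obtain v where v: "v dvd 1" "x = f \<pi> * v ^ N" by (auto simp: unit_powers_eq)
      then show "x \<in> f ` gens" using conv[OF v(1)] by (metis imageI)
    qed
    show "kummer_class N (f \<pi>) \<in> H1_mu N" by (rule kummer_class_in_H1[OF N unit])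
    fix \<beta> assume "\<beta> \<in> gens"
    then show "unit_class N (f \<beta>) = unit_class N (f \<pi>)"
      and "kummer_map N (unit_class N (f \<beta>)) = kummer_class N (f \<pi>)"
      using classes kummer_map_unit_class[OF N unit] by simp_all
  qed
qed

end
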